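(* Let $\mathcal{H}$ be a complex Hilbert space. For a $\mathcal{B}(\mathcal{H})$-valued map $T$ on $\mathbb{Z}_3$, the following are equivalent. (1) $T$ is a positive definite function. (2) The block matrix $$\Delta_T=\begin{bmatrix} T(0) & T(1) & T(1)^*\\ T(1)^* & T(0) & T(1)\\ T(1) & T(1)^* & T(0)\end{bmatrix}$$ is a bounded positive operator on $\mathcal{H}^3$. (3) $T(0)$ is positive and there are contractions $\Gamma_0:\overline{T(0)\mathcal{H}}\to\overline{T(0)\mathcal{H}}$ and $\Gamma_1:\mathfrak{D}_{\Gamma_0}\to\mathfrak{D}_{\Gamma_0^*}$ such that $$T(1)=T(0)^{1/2}\,\Gamma_0\,T(0)^{1/2}$$ and $$T(1)^*=T(0)^{1/2}D_{\Gamma_0^*}\Gamma_1D_{\Gamma_0}T(0)^{1/2}+T(0)^{1/2}\,\Gamma_0^2\,T(0)^{1/2}.$$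
   Context: $\mathcal{B}(\mathcal{H})$ is the algebra of bounded linear operators on $\mathcal{H}$; "positive" for an operator $A$ means $\langle Ax,x\rangle\ge 0$ for all $x$; a contraction is an operator of norm at most one. For a contraction $\Gamma$ on a Hilbert space, $D_\Gamma=(I-\Gamma^*\Gamma)^{1/2}$ and $\mathfrak{D}_\Gamma$ is the closure of the range of $D_\Gamma$. For a group $G$, a map $T:G\to\mathcal{B}(\mathcal{H})$ is positive definite if $T(s^{-1})=T(s)^*$ for every $s\in G$ and $\sum_{s\in G}\sum_{t\in G}\langle T(t^{-1}s)h(s),h(t)\rangle\ge 0$ for every finitely supported function $h:G\to\mathcal{H}$. $\mathbb{Z}_3=\{0,1,2\}$ is the (additive) cyclic group of order 3.
   Formalization: The formal statement additionally assumes T(2)=T(1)^*, without which (2) does not imply (1), as T(0)=I, T(1)=0, T(2)=I shows; (1) forces this assumption, and (2) and (3) do not involve T(2). *)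

theory Defs
  imports "HOL-Analysis.Analysis" "HOL-Library.Numeral_Type"
begin

text \<open>
  A complex Hilbert space: the inner product \<open>cinner\<close> is linear in its first argument, and its
  real part is the library's real inner product, so that norm, topology and completeness
  are those of the library.
\<close>

class chilbert_space = real_inner + complete_space +
  fixes scaleC :: "complex \<Rightarrow> 'a \<Rightarrow> 'a"  (infixr "*\<^sub>C" 75)
    and cinner :: "'a \<Rightarrow> 'a \<Rightarrow> complex"
  assumes scaleC_add_right: "a *\<^sub>C (x + y) = a *\<^sub>C x + a *\<^sub>C y"
    and scaleC_add_left: "(a + b) *\<^sub>C x = a *\<^sub>C x + b *\<^sub>C x"
    and scaleC_scaleC: "a *\<^sub>C b *\<^sub>C x = (a * b) *\<^sub>C x"
    and scaleR_scaleC: "r *\<^sub>R x = complex_of_real r *\<^sub>C x"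
    and cinner_commute: "cinner x y = cnj (cinner y x)"
    and cinner_add_left: "cinner (x + y) z = cinner x z + cinner y z"
    and cinner_scaleC_left: "cinner (a *\<^sub>C x) y = a * cinner x y"
    and Re_cinner: "Re (cinner x y) = inner x y"

instantiation complex :: chilbert_space
begin

definition scaleC_complex :: "complex \<Rightarrow> complex \<Rightarrow> complex"
  where "scaleC_complex a x = a * x"

definition cinner_complex :: "complex \<Rightarrow> complex \<Rightarrow> complex"
  where "cinner_complex x y = x * cnj y"

instance
  by standard
    (simp_all add: scaleC_complex_def cinner_complex_def algebra_simps scaleR_conv_of_real
      inner_complex_def)

end

text \<open>The Hilbert direct sum.\<close>

instantiation prod :: (chilbert_space, chilbert_space) chilbert_space
begin

definition scaleC_prod :: "complex \<Rightarrow> 'a \<times> 'b \<Rightarrow> 'a \<times> 'b"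
  where "scaleC_prod a p = (a *\<^sub>C fst p, a *\<^sub>C snd p)"

definition cinner_prod :: "'a \<times> 'b \<Rightarrow> 'a \<times> 'b \<Rightarrow> complex"
  where "cinner_prod p q = cinner (fst p) (fst q) + cinner (snd p) (snd q)"

instance
proof
  fix p q :: "'a \<times> 'b"
  show "cinner p q = cnj (cinner q p)"
    by (simp add: cinner_prod_def cinner_commute[symmetric])
qed (simp_all add: scaleC_prod_def cinner_prod_def scaleC_add_right scaleC_add_left
      scaleC_scaleC scaleR_scaleC scaleR_prod_def cinner_add_left cinner_scaleC_left Re_cinner
      inner_prod_def algebra_simps)

end

text \<open>
  Operators between (closed, complex) subspaces \<open>M\<close> and \<open>N\<close> are represented by
  functions on the ambient types of which only the values on \<open>M\<close> matter.
\<close>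

definition bounded_op_on ::
    "'a::chilbert_space set \<Rightarrow> 'b::chilbert_space set \<Rightarrow> ('a \<Rightarrow> 'b) \<Rightarrow> bool"
  where "bounded_op_on M N A \<longleftrightarrow>
    (\<forall>x\<in>M. A x \<in> N) \<and>
    (\<forall>x\<in>M. \<forall>y\<in>M. A (x + y) = A x + A y) \<and>
    (\<forall>c. \<forall>x\<in>M. A (c *\<^sub>C x) = c *\<^sub>C A x) \<and>
    (\<exists>K. \<forall>x\<in>M. norm (A x) \<le> K * norm x)"

abbreviation bounded_op :: "('a::chilbert_space \<Rightarrow> 'b::chilbert_space) \<Rightarrow> bool"
  where "bounded_op \<equiv> bounded_op_on UNIV UNIV"

lemma bounded_op_iff:
  "bounded_op A \<longleftrightarrow> bounded_linear A \<and> (\<forall>c x. A (c *\<^sub>C x) = c *\<^sub>C A x)"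
proof
  assume A: "bounded_op A"
  then obtain K where "\<And>x. norm (A x) \<le> K * norm x"
    by (auto simp: bounded_op_on_def)
  with A have "bounded_linear A"
    by (intro bounded_linear_intro[where K = K])
      (auto simp: bounded_op_on_def scaleR_scaleC mult.commute)
  with A show "bounded_linear A \<and> (\<forall>c x. A (c *\<^sub>C x) = c *\<^sub>C A x)"
    by (simp add: bounded_op_on_def)
next
  assume A: "bounded_linear A \<and> (\<forall>c x. A (c *\<^sub>C x) = c *\<^sub>C A x)"
  then obtain K where "\<forall>x. norm (A x) \<le> norm x * K"
    using bounded_linear.bounded by blast
  then have "\<exists>K. \<forall>x. norm (A x) \<le> K * norm x"
    by (auto simp: mult.commute)
  with A show "bounded_op A"
    by (simp add: bounded_op_on_def linear_add bounded_linear.linear)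
qed

definition op_norm_on :: "'a::chilbert_space set \<Rightarrow> ('a \<Rightarrow> 'b::chilbert_space) \<Rightarrow> real"
  where "op_norm_on M A = (SUP x\<in>M. norm (A x) / norm x)"

definition contraction_on ::
    "'a::chilbert_space set \<Rightarrow> 'b::chilbert_space set \<Rightarrow> ('a \<Rightarrow> 'b) \<Rightarrow> bool"
  where "contraction_on M N A \<longleftrightarrow> bounded_op_on M N A \<and> op_norm_on M A \<le> 1"

definition positive_on :: "'a::chilbert_space set \<Rightarrow> ('a \<Rightarrow> 'a) \<Rightarrow> bool"
  where "positive_on M A \<longleftrightarrow> (\<forall>x\<in>M. cinner (A x) x \<in> \<real>\<^sub>\<ge>\<^sub>0)"

abbreviation positive_op :: "('a::chilbert_space \<Rightarrow> 'a) \<Rightarrow> bool"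
  where "positive_op \<equiv> positive_on UNIV"

text \<open>
  The adjoint \<open>N \<rightarrow> M\<close> of \<open>A : M \<rightarrow> N\<close>. The codomain \<open>N\<close> is not a parameter: the value of the
  adjoint at \<open>y \<in> N\<close> is the same for every \<open>N\<close> that contains \<open>y\<close> and the range of \<open>A\<close>.
\<close>

definition adjoint_on ::
    "'a::chilbert_space set \<Rightarrow> ('a \<Rightarrow> 'b::chilbert_space) \<Rightarrow> 'b \<Rightarrow> 'a"
  where "adjoint_on M A y = (THE z. z \<in> M \<and> (\<forall>x\<in>M. cinner (A x) y = cinner x z))"

abbreviation adjoint_op :: "('a::chilbert_space \<Rightarrow> 'b::chilbert_space) \<Rightarrow> 'b \<Rightarrow> 'a"
  where "adjoint_op \<equiv> adjoint_on UNIV"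

text \<open>
  The positive square root of a positive operator on \<open>M\<close>. It is unique only as an operator on
  \<open>M\<close>, so its values outside \<open>M\<close> are fixed to be \<open>0\<close>.
\<close>

definition sqrt_on :: "'a::chilbert_space set \<Rightarrow> ('a \<Rightarrow> 'a) \<Rightarrow> 'a \<Rightarrow> 'a"
  where "sqrt_on M A = (THE B. bounded_op_on M M B \<and> positive_on M B \<and>
    (\<forall>x\<in>M. B (B x) = A x) \<and> (\<forall>x. x \<notin> M \<longrightarrow> B x = 0))"

abbreviation sqrt_op :: "('a::chilbert_space \<Rightarrow> 'a) \<Rightarrow> 'a \<Rightarrow> 'a"
  where "sqrt_op \<equiv> sqrt_on UNIV"

definition defect_op :: "'a::chilbert_space set \<Rightarrow> ('a \<Rightarrow> 'b::chilbert_space) \<Rightarrow> 'a \<Rightarrow> 'a"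
  where "defect_op M \<Gamma> = sqrt_on M (\<lambda>x. x - adjoint_on M \<Gamma> (\<Gamma> x))"

definition defect_space :: "'a::chilbert_space set \<Rightarrow> ('a \<Rightarrow> 'b::chilbert_space) \<Rightarrow> 'a set"
  where "defect_space M \<Gamma> = closure (defect_op M \<Gamma> ` M)"

text \<open>
  Groups are written additively (the class \<open>group_add\<close> does not assume commutativity), so
  \<open>t\<^sup>-\<^sup>1 s\<close> reads \<open>- t + s\<close>.
\<close>

definition positive_definite_fun ::
    "('g::group_add \<Rightarrow> 'a::chilbert_space \<Rightarrow> 'a) \<Rightarrow> bool"
  where "positive_definite_fun T \<longleftrightarrow>
    (\<forall>s. T (- s) = adjoint_op (T s)) \<and>
    (\<forall>h. finite {s. h s \<noteq> 0} \<longrightarrow>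
      (\<Sum>s | h s \<noteq> 0. \<Sum>t | h t \<noteq> 0. cinner (T (- t + s) (h s)) (h t)) \<in> \<real>\<^sub>\<ge>\<^sub>0)"

text \<open>
  The type \<open>3\<close> of integers modulo three serves as the cyclic group of order three; its elements
  are \<open>0\<close>, \<open>1\<close>, \<open>2\<close>. The matrix below does not mention \<open>T 2\<close>; it is the matrix with entry
  \<open>T (s - t)\<close> in row \<open>t\<close> and column \<open>s\<close> exactly when \<open>T 2\<close> is the adjoint of \<open>T 1\<close>, which the
  equivalence with positive definiteness therefore has to assume.
\<close>

definition block_op :: "(3 \<Rightarrow> 'a::chilbert_space \<Rightarrow> 'a) \<Rightarrow> 'a \<times> 'a \<times> 'a \<Rightarrow> 'a \<times> 'a \<times> 'a"
  where "block_op T = (\<lambda>(x, y, z).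
    (T 0 x              + T 1 y              + adjoint_op (T 1) z,
     adjoint_op (T 1) x + T 0 y              + T 1 z,
     T 1 x              + adjoint_op (T 1) y + T 0 z))"

end

theory Submission
  imports Defs
begin

text \<open>
  Write \<open>S = T(0)\<^sup>1\<^sup>/\<^sup>2\<close>. Nonnegativity of the block form on vectors \<open>(x, y, 0)\<close> says
  \<open>|\<langle>T(1) y, x\<rangle>| \<le> \<parallel>S y\<parallel> \<parallel>S x\<parallel>\<close>, and a form with such a bound factors as \<open>T(1) = S \<Gamma>\<^sub>0 S\<close> with a
  contraction \<open>\<Gamma>\<^sub>0\<close>. In the variables \<open>u = S x\<close>, \<open>v = S y\<close>, \<open>w = S z\<close> the form then equals
  \<open>\<parallel>v + \<Gamma>\<^sub>0* u + \<Gamma>\<^sub>0 w\<parallel>\<^sup>2 + \<parallel>D' u\<parallel>\<^sup>2 + \<parallel>D w\<parallel>\<^sup>2 + 2 Re \<langle>(\<Gamma>\<^sub>0* - \<Gamma>\<^sub>0\<^sup>2) w, u\<rangle>\<close>, where \<open>D\<close> and \<open>D'\<close> are the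
  defect operators of \<open>\<Gamma>\<^sub>0\<close> and \<open>\<Gamma>\<^sub>0*\<close>. Choosing \<open>v\<close> to kill the first square, the same factorization
  gives \<open>\<Gamma>\<^sub>0* - \<Gamma>\<^sub>0\<^sup>2 = D' \<Gamma>\<^sub>1 D\<close>; conversely such a \<open>\<Gamma>\<^sub>1\<close> makes the form nonnegative.
\<close>

section \<open>Complex scalars and the real inner product\<close>

instance chilbert_space \<subseteq> banach ..

text \<open>Most of the development works with the real inner product; this rule carries complex
  homogeneity through it, a scalar crossing over as its conjugate.\<close>

lemma inner_scaleC_left:
  fixes x y :: "'a::chilbert_space"
  shows "inner (c *\<^sub>C x) y = inner x (cnj c *\<^sub>C y)"
proof -
  have "cinner (c *\<^sub>C x) y = cinner x (cnj c *\<^sub>C y)"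
    by (metis cinner_commute cinner_scaleC_left complex_cnj_cnj complex_cnj_mult)
  then show ?thesis
    by (metis Re_cinner)
qed

lemma Im_cinner: "Im (cinner x y) = - inner (\<i> *\<^sub>C x) y"
  by (simp add: Re_cinner[symmetric] cinner_scaleC_left)

text \<open>The complex inner product is recovered from the real one and multiplication by the
  imaginary unit, so an identity for \<open>inner\<close> over a complex subspace yields the one for
  \<open>cinner\<close>.\<close>

lemma cinner_eq_Complex: "cinner x y = Complex (inner x y) (- inner (\<i> *\<^sub>C x) y)"
  by (simp add: complex_eq_iff Re_cinner Im_cinner)

lemma norm_scaleC: "norm (c *\<^sub>C x) = cmod c * norm (x :: 'a::chilbert_space)"
proof -
  have "cnj c *\<^sub>C c *\<^sub>C x = (cmod c)\<^sup>2 *\<^sub>R x"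
    by (simp add: scaleC_scaleC scaleR_scaleC mult.commute complex_norm_square del: of_real_power)
  then have "(norm (c *\<^sub>C x))\<^sup>2 = (cmod c * norm x)\<^sup>2"
    by (simp add: power2_norm_eq_inner inner_scaleC_left power_mult_distrib)
  then show ?thesis
    by simp
qed

lemma scaleC_one [simp]: "1 *\<^sub>C x = x"
  using scaleR_scaleC[of 1 x] by simp

lemma scaleC_minus_left: "(- c) *\<^sub>C x = - (c *\<^sub>C x)"
proof -
  have "0 *\<^sub>C x = 0"
    using scaleR_scaleC[of 0 x] by simp
  then show ?thesis
    using scaleC_add_left[of "- c" c x] by (simp add: eq_neg_iff_add_eq_0)
qed

lemma scaleC_zero_right [simp]: "c *\<^sub>C 0 = 0"
  using norm_scaleC[of c 0] by simp

lemma scaleC_minus_right: "c *\<^sub>C (- x) = - (c *\<^sub>C x)"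
  using scaleC_add_right[of c x "- x"] by (simp add: add_eq_0_iff)

lemma scaleC_diff_right: "c *\<^sub>C (x - y) = c *\<^sub>C x - c *\<^sub>C y"
  using scaleC_add_right[of c x "- y"] by (simp add: scaleC_minus_right)

lemma scaleC_scaleR: "c *\<^sub>C r *\<^sub>R x = r *\<^sub>R c *\<^sub>C x"
  by (simp add: scaleR_scaleC scaleC_scaleC mult.commute)

lemma bounded_linear_scaleC: "bounded_linear ((*\<^sub>C) c)"
  by (rule bounded_linear_intro[where K = "cmod c"])
    (simp_all add: scaleC_add_right scaleC_scaleR norm_scaleC)

lemmas tendsto_scaleC = bounded_linear.tendsto[OF bounded_linear_scaleC]

section \<open>Complex subspaces\<close>

text \<open>Closedness is kept apart, because ranges of operators have to count as subspaces before
  their closures are taken.\<close>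

definition csubspace :: "'a::chilbert_space set \<Rightarrow> bool"
  where "csubspace M \<longleftrightarrow>
    0 \<in> M \<and> (\<forall>x\<in>M. \<forall>y\<in>M. x + y \<in> M) \<and> (\<forall>c. \<forall>x\<in>M. c *\<^sub>C x \<in> M)"

lemma csubspace_UNIV [simp]: "csubspace UNIV"
  by (simp add: csubspace_def)

context
  fixes M :: "'a::chilbert_space set"
  assumes M: "csubspace M"
begin

lemma csubspace_0: "0 \<in> M"
  and csubspace_add: "x \<in> M \<Longrightarrow> y \<in> M \<Longrightarrow> x + y \<in> M"
  and csubspace_scaleC: "x \<in> M \<Longrightarrow> c *\<^sub>C x \<in> M"
  using M by (auto simp: csubspace_def)

lemma csubspace_scaleR: "x \<in> M \<Longrightarrow> r *\<^sub>R x \<in> M"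
  by (simp add: scaleR_scaleC csubspace_scaleC)

lemma csubspace_minus: "x \<in> M \<Longrightarrow> - x \<in> M"
  using csubspace_scaleR[of x "-1"] by simp

lemma csubspace_diff: "x \<in> M \<Longrightarrow> y \<in> M \<Longrightarrow> x - y \<in> M"
  using csubspace_add[of x "- y"] csubspace_minus by simp

lemma csubspace_closure: "csubspace (closure M)"
  unfolding csubspace_def
proof (intro conjI ballI allI)
  show "0 \<in> closure M"
    using csubspace_0 closure_subset by blast
next
  fix x y assume "x \<in> closure M" "y \<in> closure M"
  then obtain f g where "\<And>n. f n \<in> M" "f \<longlonglongrightarrow> x" "\<And>n. g n \<in> M" "g \<longlonglongrightarrow> y"
    by (auto simp: closure_sequential)
  then show "x + y \<in> closure M"
    unfolding closure_sequential
    by (intro exI[of _ "\<lambda>n. f n + g n"]) (auto intro: tendsto_add csubspace_add)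
next
  fix c x assume "x \<in> closure M"
  then obtain f where "\<And>n. f n \<in> M" "f \<longlonglongrightarrow> x"
    by (auto simp: closure_sequential)
  then show "c *\<^sub>C x \<in> closure M"
    unfolding closure_sequential
    by (intro exI[of _ "\<lambda>n. c *\<^sub>C f n"]) (auto intro: tendsto_scaleC csubspace_scaleC)
qed

end

section \<open>Operators on a subspace and representation of functionals\<close>

context
  fixes M :: "'a::chilbert_space set"
  assumes M: "csubspace M"
begin

text \<open>The difference lies in the closure and is orthogonal to \<open>M\<close>, hence to
  itself. This is the uniqueness half of every representation argument below.\<close>

lemma inner_closure_eqD:
  assumes "g \<in> closure M" "g' \<in> closure M" "\<And>y. y \<in> M \<Longrightarrow> inner y g = inner y g'"
  shows "g = g'"
proof -
  have "closure M \<subseteq> {u. inner (g - g') u = 0}"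
    using assms(3) by (intro closure_minimal closed_hyperplane) (auto simp: inner_diff_right inner_commute[of "g - g'"])
  moreover have "g - g' \<in> closure M"
    using csubspace_diff[OF csubspace_closure[OF M]] assms(1,2) by blast
  ultimately have "inner (g - g') (g - g') = 0"
    by blast
  then show ?thesis
    by simp
qed

lemma bounded_op_onD:
  assumes "bounded_op_on M N A"
  shows "x \<in> M \<Longrightarrow> A x \<in> N"
    and bounded_op_on_add: "x \<in> M \<Longrightarrow> y \<in> M \<Longrightarrow> A (x + y) = A x + A y"
    and bounded_op_on_scaleC: "x \<in> M \<Longrightarrow> A (c *\<^sub>C x) = c *\<^sub>C A x"
    and bounded_op_on_scaleR: "x \<in> M \<Longrightarrow> A (r *\<^sub>R x) = r *\<^sub>R A x"
    and bounded_op_on_minus: "x \<in> M \<Longrightarrow> A (- x) = - A x"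
    and bounded_op_on_diff: "x \<in> M \<Longrightarrow> y \<in> M \<Longrightarrow> A (x - y) = A x - A y"
    and bounded_op_on_zero: "A 0 = 0"
proof -
  have *: "A (x + y) = A x + A y" "A (c *\<^sub>C x) = c *\<^sub>C A x" if "x \<in> M" "y \<in> M" for x y c
    using assms that by (auto simp: bounded_op_on_def)
  show R: "A (r *\<^sub>R x) = r *\<^sub>R A x" if "x \<in> M" for x r
    using that by (simp add: scaleR_scaleC *)
  show m: "A (- x) = - A x" if "x \<in> M" for x
    using R[OF that, of "-1"] by simp
  show "A (x - y) = A x - A y" if "x \<in> M" "y \<in> M"
    using *(1)[OF that(1) csubspace_minus[OF M that(2)]] m[OF that(2)] by simp
  show "A 0 = 0"
    using R[OF csubspace_0[OF M], of 0] by simp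
qed (use assms in \<open>auto simp: bounded_op_on_def\<close>)

lemma bounded_op_on_bound:
  assumes "bounded_op_on M N A"
  obtains c where "c > 0" "\<And>x. x \<in> M \<Longrightarrow> norm (A x) \<le> c * norm x"
proof -
  obtain k where k: "\<And>x. x \<in> M \<Longrightarrow> norm (A x) \<le> k * norm x"
    using assms unfolding bounded_op_on_def by metis
  show thesis
  proof
    show "0 < \<bar>k\<bar> + 1" by simp
    fix x assume "x \<in> M"
    have "k * norm x \<le> (\<bar>k\<bar> + 1) * norm x"
      by (rule mult_right_mono) auto
    then show "norm (A x) \<le> (\<bar>k\<bar> + 1) * norm x"
      using k[OF \<open>x \<in> M\<close>] by linarith
  qed
qed

lemma bounded_op_on_tendsto:
  assumes "bounded_op_on M N A" "\<And>n. f n \<in> M" "x \<in> M" "f \<longlonglongrightarrow> x"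
  shows "(\<lambda>n. A (f n)) \<longlonglongrightarrow> A x"
proof -
  obtain c where c: "\<And>x. x \<in> M \<Longrightarrow> norm (A x) \<le> c * norm x"
    using bounded_op_on_bound[OF assms(1)] by metis
  have "(\<lambda>n. c * norm (f n - x)) \<longlonglongrightarrow> 0"
    using tendsto_mult_right_zero[OF tendsto_norm_zero[OF LIM_zero[OF assms(4)]]] .
  then have "(\<lambda>n. A (f n) - A x) \<longlonglongrightarrow> 0"
  proof (rule Lim_null_comparison[rotated], intro always_eventually allI)
    fix n show "norm (A (f n) - A x) \<le> c * norm (f n - x)"
      using c[of "f n - x"] by (simp add: assms csubspace_diff[OF M] bounded_op_on_diff[OF assms(1)])
  qed
  then show ?thesis
    by (rule LIM_zero_cancel)
qed

lemma csubspace_image: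
  assumes "bounded_op_on M N A"
  shows "csubspace (A ` M)"
proof -
  note [simp] = bounded_op_on_add[OF assms, symmetric] bounded_op_on_scaleC[OF assms, symmetric]
  show ?thesis
    unfolding csubspace_def
    using bounded_op_on_zero[OF assms] csubspace_0[OF M] by (auto intro: csubspace_add[OF M] csubspace_scaleC[OF M])
qed

text \<open>Boundedness of \<open>A\<close> gives the supremum in \<open>op_norm_on\<close> its
  meaning. The supremum also ranges over \<open>0\<close>, where division by zero makes the quotient
  \<open>0\<close>.\<close>

lemma contraction_on_iff:
  "contraction_on M N A \<longleftrightarrow> bounded_op_on M N A \<and> (\<forall>x\<in>M. norm (A x) \<le> norm x)"
proof (cases "bounded_op_on M N A")
  case True
  then obtain c where c: "c > 0" "\<And>x. x \<in> M \<Longrightarrow> norm (A x) \<le> c * norm x"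
    using bounded_op_on_bound by metis
  have A0: "A 0 = 0"
    using True by (rule bounded_op_on_zero)
  have "bdd_above ((\<lambda>x. norm (A x) / norm x) ` M)"
  proof (rule bdd_aboveI2[where M = c])
    fix x assume "x \<in> M"
    then show "norm (A x) / norm x \<le> c"
      using c by (cases "x = 0") (auto simp: divide_simps)
  qed
  then have "op_norm_on M A \<le> 1 \<longleftrightarrow> (\<forall>x\<in>M. norm (A x) / norm x \<le> 1)"
    unfolding op_norm_on_def using csubspace_0[OF M] by (subst cSUP_le_iff) auto
  also have "\<dots> \<longleftrightarrow> (\<forall>x\<in>M. norm (A x) \<le> norm x)"
    using A0 by (intro ball_cong refl) (auto simp: divide_simps)
  finally show ?thesis
    using True by (simp add: contraction_on_def)
qed (simp add: contraction_on_def)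

text \<open>
  The functional is represented by an element of the closure of the range of \<open>Q\<close>, the limit of
  \<open>Q s\<^sub>n\<close> for a sequence minimising \<open>\<parallel>Q y\<parallel>\<^sup>2 - 2 f y\<close>. With \<open>Q = id\<close> this is the Riesz theorem.
\<close>

lemma Riesz_along_map:
  fixes Q :: "'a \<Rightarrow> 'b::chilbert_space"
  assumes Q: "bounded_op_on M UNIV Q"
    and f_add: "\<And>x y. x \<in> M \<Longrightarrow> y \<in> M \<Longrightarrow> f (x + y) = f x + f y"
    and f_scale: "\<And>r x. x \<in> M \<Longrightarrow> f (r *\<^sub>R x) = r * f x"
    and c: "0 \<le> c" and f_bound: "\<And>x. x \<in> M \<Longrightarrow> \<bar>f x\<bar> \<le> c * norm (Q x)"
  shows "\<exists>g. g \<in> closure (Q ` M) \<and> (\<forall>y\<in>M. f y = inner (Q y) g) \<and> norm g \<le> c"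
proof -
  note [simp] = bounded_op_on_add[OF Q] bounded_op_on_scaleR[OF Q] csubspace_add[OF M] csubspace_scaleR[OF M]
    f_add f_scale
  define \<phi> where "\<phi> y = (norm (Q y))\<^sup>2 - 2 * f y" for y
  define m where "m = Inf (\<phi> ` M)"
  have lower: "- c\<^sup>2 \<le> \<phi> y" if "y \<in> M" for y
  proof -
    have "0 \<le> (norm (Q y) - c)\<^sup>2" by simp
    then show ?thesis
      using f_bound[OF that] by (simp add: \<phi>_def power2_diff mult.commute)
  qed
  then have bdd: "bdd_below (\<phi> ` M)"
    by (auto intro!: bdd_belowI2)
  have m_le: "m \<le> \<phi> y" if "y \<in> M" for y
    unfolding m_def by (rule cINF_lower[OF bdd that])
  define \<delta> :: "nat \<Rightarrow> real" where "\<delta> n = 1 / Suc n" for n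
  have "\<exists>y\<in>M. \<phi> y < m + \<delta> n" for n
    using cInf_lessD[of "\<phi> ` M" "m + \<delta> n"] csubspace_0[OF M] by (force simp: m_def \<delta>_def)
  then obtain s where s: "s n \<in> M" "\<phi> (s n) < m + \<delta> n" for n
    by metis
  have inv0: "\<delta> \<longlonglongrightarrow> 0"
    unfolding \<delta>_def using LIMSEQ_inverse_real_of_nat by (simp add: inverse_eq_divide)
  \<comment> \<open>Parallelogram law: the midpoint of \<open>s n\<close> and \<open>s k\<close>
    cannot push \<open>\<phi>\<close> below its infimum \<open>m\<close>.\<close>
  have close: "(norm (Q (s n) - Q (s k)))\<^sup>2 \<le> 2 * \<delta> n + 2 * \<delta> k" for n k
  proof -
    have "m \<le> \<phi> ((1/2) *\<^sub>R (s n + s k))"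
      by (rule m_le) (simp add: s(1))
    also have "\<phi> ((1/2) *\<^sub>R (s n + s k)) = (norm (Q (s n) + Q (s k)))\<^sup>2 / 4 - f (s n) - f (s k)"
      by (simp add: \<phi>_def s(1) power_divide del: scaleR_half_double scaleR_add_right)
        (simp add: field_simps)
    also have "\<dots> = (\<phi> (s n) + \<phi> (s k)) / 2 - (norm (Q (s n) - Q (s k)))\<^sup>2 / 4"
      by (simp add: \<phi>_def power2_norm_eq_inner inner_simps inner_commute field_simps)
    finally show ?thesis
      using s(2)[of n] s(2)[of k] by argo
  qed
  have "Cauchy (\<lambda>n. Q (s n))"
    unfolding Cauchy_iff
  proof (intro allI impI)
    fix e :: real assume "0 < e"
    then obtain N where N: "\<delta> N < e\<^sup>2 / 4"
      using nat_approx_posE[of "e\<^sup>2 / 4"] by (auto simp: \<delta>_def divide_simps)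
    have "norm (Q (s n) - Q (s k)) < e" if "n \<ge> N" "k \<ge> N" for n k
    proof -
      have "\<delta> n \<le> \<delta> N" "\<delta> k \<le> \<delta> N"
        unfolding \<delta>_def using that by (auto intro!: divide_left_mono)
      with N have "2 * \<delta> n + 2 * \<delta> k < e\<^sup>2"
        by linarith
      with close[of n k] have "(norm (Q (s n) - Q (s k)))\<^sup>2 < e\<^sup>2"
        by linarith
      then show ?thesis
        using \<open>0 < e\<close> by (simp add: power_less_imp_less_base)
    qed
    then show "\<exists>N. \<forall>m\<ge>N. \<forall>n\<ge>N. norm (Q (s m) - Q (s n)) < e"
      by blast
  qed
  then obtain g where g: "(\<lambda>n. Q (s n)) \<longlonglongrightarrow> g"
    by (auto simp: Cauchy_convergent_iff convergent_def)
  have eq: "f y = inner (Q y) g" if y: "y \<in> M" for y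
  proof -
    define d where "d = inner g (Q y) - f y"
    \<comment> \<open>Perturbing the minimising sequence by \<open>t *\<^sub>R y\<close> and passing
      to the limit gives a quadratic in \<open>t\<close> without constant term that is never
      negative; its linear coefficient \<open>d\<close> must vanish.\<close>
    have quad: "0 \<le> 2 * t * d + t\<^sup>2 * (norm (Q y))\<^sup>2" for t
    proof (rule LIMSEQ_le)
      show "(\<lambda>n. - \<delta> n) \<longlonglongrightarrow> 0"
        using tendsto_minus[OF inv0] by simp
      show "(\<lambda>n. 2 * t * (inner (Q (s n)) (Q y) - f y) + t\<^sup>2 * (norm (Q y))\<^sup>2) \<longlonglongrightarrow>
          2 * t * d + t\<^sup>2 * (norm (Q y))\<^sup>2"
        unfolding d_def by (intro tendsto_intros g)
      have "- \<delta> n \<le> 2 * t * (inner (Q (s n)) (Q y) - f y) + t\<^sup>2 * (norm (Q y))\<^sup>2" for n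
      proof -
        have "m \<le> \<phi> (s n + t *\<^sub>R y)"
          by (rule m_le) (simp add: s(1) y)
        also have "\<dots> = \<phi> (s n) + 2 * t * (inner (Q (s n)) (Q y) - f y) + t\<^sup>2 * (norm (Q y))\<^sup>2"
          by (simp add: \<phi>_def s(1) y power2_norm_eq_inner inner_simps inner_commute
              power2_eq_square[of t] algebra_simps)
        finally show ?thesis
          using s(2)[of n] by linarith
      qed
      then show "\<exists>N. \<forall>n\<ge>N. - \<delta> n \<le>
          2 * t * (inner (Q (s n)) (Q y) - f y) + t\<^sup>2 * (norm (Q y))\<^sup>2"
        by blast
    qed
    \<comment> \<open>The summand 1 allows division even if \<open>Q y = 0\<close>; at
      \<open>t = - d / q\<close> the quadratic is negative unless \<open>d = 0\<close>.\<close>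
    define q where "q = (norm (Q y))\<^sup>2 + 1"
    have "q > 0" by (simp add: q_def add_nonneg_pos)
    have "0 \<le> 2 * (- d / q) * d + (- d / q)\<^sup>2 * (q - 1)"
      using quad[of "- d / q"] by (simp add: q_def)
    also have "\<dots> = - (d\<^sup>2 / q) - d\<^sup>2 / q\<^sup>2"
      using \<open>q > 0\<close> by (simp add: field_simps power2_eq_square)
    finally have "d\<^sup>2 / q + d\<^sup>2 / q\<^sup>2 \<le> 0" by simp
    moreover have "d\<^sup>2 / q \<ge> 0" "d\<^sup>2 / q\<^sup>2 \<ge> 0" using \<open>q > 0\<close> by simp_all
    ultimately have "d\<^sup>2 / q = 0" by linarith
    then have "d = 0" using \<open>q > 0\<close> by simp
    then show ?thesis by (simp add: d_def inner_commute)
  qed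
  \<comment> \<open>The bound on \<open>f\<close> at \<open>s n\<close>, where \<open>f\<close>
    equals \<open>inner (Q (s n)) g\<close>, passes to the limit.\<close>
  have "inner g g \<le> c * norm g"
  proof (rule LIMSEQ_le)
    show "(\<lambda>n. inner (Q (s n)) g) \<longlonglongrightarrow> inner g g" "(\<lambda>n. c * norm (Q (s n))) \<longlonglongrightarrow> c * norm g"
      by (intro tendsto_intros g)+
    show "\<exists>N. \<forall>n\<ge>N. inner (Q (s n)) g \<le> c * norm (Q (s n))"
      using eq[OF s(1)] f_bound[OF s(1)] by (metis abs_le_D1)
  qed
  then have "norm g * norm g \<le> c * norm g"
    by (simp add: dot_square_norm power2_eq_square)
  then have "norm g \<le> c"
    using c by (cases "g = 0") auto
  moreover have "g \<in> closure (Q ` M)"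
    unfolding closure_sequential using g s(1) by (intro exI[of _ "\<lambda>n. Q (s n)"]) auto
  ultimately show ?thesis
    using eq by blast
qed

end


section \<open>Factorization of dominated forms\<close>

lemma bounded_op_onI:
  assumes "\<And>x. x \<in> M \<Longrightarrow> A x \<in> N" "\<And>x y. x \<in> M \<Longrightarrow> y \<in> M \<Longrightarrow> A (x + y) = A x + A y"
    "\<And>c x. x \<in> M \<Longrightarrow> A (c *\<^sub>C x) = c *\<^sub>C A x" "\<And>x. x \<in> M \<Longrightarrow> norm (A x) \<le> k * norm x"
  shows "bounded_op_on M N A"
  using assms unfolding bounded_op_on_def by blast

text \<open>
  Two applications of the Riesz lemma, first along \<open>P\<close> and then along \<open>Q\<close>, define \<open>G\<close> on the
  whole closure of the range of \<open>P\<close>, so that no extension by continuity is needed.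
\<close>

lemma form_factorization:
  fixes P :: "'a::chilbert_space \<Rightarrow> 'c::chilbert_space"
    and Q :: "'b::chilbert_space \<Rightarrow> 'd::chilbert_space" and B :: "'a \<Rightarrow> 'b"
  assumes M: "csubspace M" and N: "csubspace N" and P: "bounded_op_on M UNIV P"
    and Q: "bounded_op_on N UNIV Q" and B: "bounded_op_on M UNIV B"
    and le: "\<And>x y. x \<in> M \<Longrightarrow> y \<in> N \<Longrightarrow> \<bar>inner (B x) y\<bar> \<le> norm (P x) * norm (Q y)"
  obtains G where "contraction_on (closure (P ` M)) (closure (Q ` N)) G"
    "\<And>x y. x \<in> M \<Longrightarrow> y \<in> N \<Longrightarrow> inner (B x) y = inner (G (P x)) (Q y)"
proof -
  note PM = csubspace_image[OF M P] and QN = csubspace_image[OF N Q]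
  note CP = csubspace_closure[OF PM] and CQ = csubspace_closure[OF QN]
  have "\<exists>h. h \<in> closure (P ` M) \<and> (\<forall>x\<in>M. inner (B x) y = inner (P x) h) \<and> norm h \<le> norm (Q y)"
    if "y \<in> N" for y
    by (rule Riesz_along_map[OF M P])
      (use le that in \<open>auto simp: bounded_op_on_add[OF M B] bounded_op_on_scaleR[OF M B] inner_add_left
        mult.commute\<close>)
  then obtain h where h: "\<And>y. y \<in> N \<Longrightarrow> h y \<in> closure (P ` M)"
      "\<And>x y. x \<in> M \<Longrightarrow> y \<in> N \<Longrightarrow> inner (B x) y = inner (P x) (h y)"
      "\<And>y. y \<in> N \<Longrightarrow> norm (h y) \<le> norm (Q y)"
    by metis
  \<comment> \<open>The vectors \<open>h y\<close> are chosen one by one; linearity follows since an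
    element of the closure of \<open>P\<close>
    M\<open>is determined by its inner products with\<close>P \<open>M\<close>.\<close>
  have h_add: "h (y + z) = h y + h z" if "y \<in> N" "z \<in> N" for y z
  proof (rule inner_closure_eqD[OF PM])
    fix p assume "p \<in> P ` M"
    then show "inner p (h (y + z)) = inner p (h y + h z)"
      using that by (auto simp: inner_add_right h(2)[symmetric] csubspace_add[OF N])
  qed (auto intro: h that csubspace_add[OF N] csubspace_add[OF CP])
  \<comment> \<open>The Riesz lemma represents real functionals only, so complex homogeneity is
    obtained by moving the scalar to the other argument and back.\<close>
  have h_scaleC: "h (c *\<^sub>C y) = c *\<^sub>C h y" if "y \<in> N" for c y
  proof (rule inner_closure_eqD[OF PM])
    fix p assume "p \<in> P ` M"
    then obtain x where x: "x \<in> M" "p = P x" by blast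
    have "inner p (h (c *\<^sub>C y)) = inner (B x) (c *\<^sub>C y)"
      using x that by (simp add: h(2) csubspace_scaleC[OF N])
    also have "\<dots> = inner (B (cnj c *\<^sub>C x)) y"
      by (simp add: bounded_op_on_scaleC[OF M B x(1)] inner_scaleC_left)
    also have "\<dots> = inner (P (cnj c *\<^sub>C x)) (h y)"
      using x that by (simp add: h(2) csubspace_scaleC[OF M])
    also have "\<dots> = inner p (c *\<^sub>C h y)"
      by (simp add: bounded_op_on_scaleC[OF M P x(1)] inner_scaleC_left x(2))
    finally show "inner p (h (c *\<^sub>C y)) = inner p (c *\<^sub>C h y)" .
  qed (auto intro: h that csubspace_scaleC[OF N] csubspace_scaleC[OF CP])
  \<comment> \<open>The second representation: \<open>G\<close> acts as an adjoint of the
    correspondence from \<open>Q y\<close> to \<open>h y\<close>, and the vector \<open>u\<close> is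
    arbitrary in the ambient space.\<close>
  have "\<exists>g. g \<in> closure (Q ` N) \<and> (\<forall>y\<in>N. inner (h y) u = inner (Q y) g) \<and> norm g \<le> norm u" for u
  proof (rule Riesz_along_map[OF N Q])
    fix y assume "y \<in> N"
    have "\<bar>inner (h y) u\<bar> \<le> norm (h y) * norm u"
      by (rule Cauchy_Schwarz_ineq2)
    also have "\<dots> \<le> norm u * norm (Q y)"
      using h(3)[OF \<open>y \<in> N\<close>] by (simp add: mult.commute mult_left_mono)
    finally show "\<bar>inner (h y) u\<bar> \<le> norm u * norm (Q y)" .
  qed (simp_all add: h_add h_scaleC scaleR_scaleC inner_add_left inner_scaleR_left[symmetric]
      del: inner_scaleR_left)
  then obtain G where G: "\<And>u. G u \<in> closure (Q ` N)"
      "\<And>u y. y \<in> N \<Longrightarrow> inner (h y) u = inner (Q y) (G u)" "\<And>u. norm (G u) \<le> norm u"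
    by metis
  have G_add: "G (u + v) = G u + G v" for u v
    by (rule inner_closure_eqD[OF QN])
      (auto simp: G(1) inner_add_right G(2)[symmetric] csubspace_add[OF CQ])
  have G_scaleC: "G (c *\<^sub>C u) = c *\<^sub>C G u" for c u
  proof (rule inner_closure_eqD[OF QN])
    fix q assume "q \<in> Q ` N"
    then obtain y where y: "y \<in> N" "q = Q y" by blast
    have "inner q (G (c *\<^sub>C u)) = inner (h (cnj c *\<^sub>C y)) u"
      using y by (simp add: G(2)[symmetric] h_scaleC inner_scaleC_left)
    also have "\<dots> = inner q (c *\<^sub>C G u)"
      using y by (simp add: G(2) csubspace_scaleC[OF N] bounded_op_on_scaleC[OF N Q] inner_scaleC_left)
    finally show "inner q (G (c *\<^sub>C u)) = inner q (c *\<^sub>C G u)" .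
  qed (auto intro: G csubspace_scaleC[OF CQ])
  show thesis
  proof
    show "contraction_on (closure (P ` M)) (closure (Q ` N)) G"
      unfolding contraction_on_iff[OF CP]
      by (intro conjI bounded_op_onI[where k = 1]) (auto simp: G G_add G_scaleC)
    show "inner (B x) y = inner (G (P x)) (Q y)" if "x \<in> M" "y \<in> N" for x y
      using h(2)[OF that] G(2)[OF that(2)] by (simp add: inner_commute)
  qed
qed

section \<open>Adjoints\<close>

context
  fixes M :: "'a::chilbert_space set" and N :: "'b::chilbert_space set" and A :: "'a \<Rightarrow> 'b"
  assumes M: "csubspace M" "closed M" and N: "csubspace N" and A: "bounded_op_on M N A"
begin

text \<open>Testing against the multiple of \<open>x\<close> by the imaginary unit, which stays in
  \<open>M\<close>, recovers the imaginary part of the defining identity. Hence the real identity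
  suffices to identify the adjoint.\<close>

lemma adjoint_on_eqI:
  assumes "z \<in> M" "\<And>x. x \<in> M \<Longrightarrow> inner (A x) y = inner x z"
  shows "adjoint_on M A y = z"
  unfolding adjoint_on_def
proof (rule the_equality)
  have "inner (\<i> *\<^sub>C A x) y = inner (\<i> *\<^sub>C x) z" if "x \<in> M" for x
    using assms(2)[of "\<i> *\<^sub>C x"] that csubspace_scaleC[OF M(1)] bounded_op_on_scaleC[OF M(1) A]
    by simp
  then show "z \<in> M \<and> (\<forall>x\<in>M. cinner (A x) y = cinner x z)"
    using assms by (simp add: cinner_eq_Complex)
next
  fix w assume w: "w \<in> M \<and> (\<forall>x\<in>M. cinner (A x) y = cinner x w)"
  show "w = z"
  proof (rule inner_closure_eqD[OF M(1)])
    show "inner x w = inner x z" if "x \<in> M" for x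
      using that w assms by (metis Re_cinner)
  qed (use w assms(1) closure_subset in blast)+
qed

text \<open>Existence is the Riesz theorem for the functional sending \<open>x\<close> to
  \<open>inner (A x) y\<close>; closedness of \<open>M\<close> keeps the representing vector in
  \<open>M\<close>.\<close>

lemma adjoint_on_in: "adjoint_on M A y \<in> M"
  and adjoint_on_inner: "x \<in> M \<Longrightarrow> inner (A x) y = inner x (adjoint_on M A y)"
proof -
  obtain c where c: "c > 0" "\<And>x. x \<in> M \<Longrightarrow> norm (A x) \<le> c * norm x"
    using bounded_op_on_bound[OF M(1) A] by blast
  have "\<exists>g. g \<in> closure (id ` M) \<and> (\<forall>x\<in>M. inner (A x) y = inner (id x) g) \<and> norm g \<le> c * norm y"
  proof (rule Riesz_along_map[OF M(1)])
    show "bounded_op_on M UNIV id"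
      by (rule bounded_op_onI[where k = 1]) simp_all
    fix x assume "x \<in> M"
    have "\<bar>inner (A x) y\<bar> \<le> norm (A x) * norm y"
      by (rule Cauchy_Schwarz_ineq2)
    also have "\<dots> \<le> (c * norm x) * norm y"
      using c \<open>x \<in> M\<close> by (intro mult_right_mono) auto
    finally show "\<bar>inner (A x) y\<bar> \<le> c * norm y * norm (id x)"
      by (simp add: mult_ac)
  qed (use c in \<open>simp_all add: bounded_op_on_add[OF M(1) A] bounded_op_on_scaleR[OF M(1) A] inner_add_left\<close>)
  then obtain g where "g \<in> M" "\<And>x. x \<in> M \<Longrightarrow> inner (A x) y = inner x g"
    using M(2) by auto
  with adjoint_on_eqI[OF this] show "adjoint_on M A y \<in> M"
    "x \<in> M \<Longrightarrow> inner (A x) y = inner x (adjoint_on M A y)"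
    by auto
qed

text \<open>With \<open>z\<close> the value of the adjoint, the square of \<open>norm z\<close> is
  \<open>inner (A z) y\<close>; Cauchy-Schwarz and cancelling \<open>norm z\<close> give the
  bound.\<close>

lemma norm_adjoint_on_le:
  assumes "0 \<le> c" "\<And>x. x \<in> M \<Longrightarrow> norm (A x) \<le> c * norm x"
  shows "norm (adjoint_on M A y) \<le> c * norm y"
proof -
  let ?z = "adjoint_on M A y"
  have "norm ?z * norm ?z = inner (A ?z) y"
    by (simp add: adjoint_on_inner adjoint_on_in dot_square_norm power2_eq_square[symmetric])
  also have "\<dots> \<le> norm (A ?z) * norm y"
    by (rule norm_cauchy_schwarz)
  also have "\<dots> \<le> (c * norm ?z) * norm y"
    using assms adjoint_on_in by (intro mult_right_mono) auto
  finally have "norm ?z * norm ?z \<le> (c * norm y) * norm ?z"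
    by (simp add: mult_ac)
  then show ?thesis
    using assms(1) by (cases "?z = 0") auto
qed

lemma bounded_op_on_adjoint: "bounded_op_on N M (adjoint_on M A)"
proof -
  obtain c where c: "c > 0" "\<And>x. x \<in> M \<Longrightarrow> norm (A x) \<le> c * norm x"
    using bounded_op_on_bound[OF M(1) A] by blast
  show ?thesis
  proof (rule bounded_op_onI[where k = c])
    show "adjoint_on M A (y + z) = adjoint_on M A y + adjoint_on M A z" for y z
      by (rule adjoint_on_eqI)
        (auto simp: adjoint_on_in csubspace_add[OF M(1)] inner_add_right adjoint_on_inner)
    show "adjoint_on M A (a *\<^sub>C y) = a *\<^sub>C adjoint_on M A y" for a y
    proof (rule adjoint_on_eqI)
      fix x assume "x \<in> M"
      have "inner (A x) (a *\<^sub>C y) = inner (A (cnj a *\<^sub>C x)) y"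
        using \<open>x \<in> M\<close> by (simp add: bounded_op_on_scaleC[OF M(1) A] inner_scaleC_left)
      also have "\<dots> = inner x (a *\<^sub>C adjoint_on M A y)"
        using \<open>x \<in> M\<close> by (simp add: adjoint_on_inner csubspace_scaleC[OF M(1)] inner_scaleC_left)
      finally show "inner (A x) (a *\<^sub>C y) = inner x (a *\<^sub>C adjoint_on M A y)" .
    qed (auto intro: adjoint_on_in csubspace_scaleC[OF M(1)])
  qed (use c in \<open>auto intro: adjoint_on_in norm_adjoint_on_le\<close>)
qed

lemma contraction_on_adjoint:
  "contraction_on M N A \<Longrightarrow> contraction_on N M (adjoint_on M A)"
  using norm_adjoint_on_le[of 1] bounded_op_on_adjoint
  by (simp add: contraction_on_iff[OF M(1)] contraction_on_iff[OF N])

end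

section \<open>Positive operators\<close>

text \<open>The real counterpart of positivity. Symmetry is a separate clause because nonnegativity
  of the real quadratic form does not imply it.\<close>

definition psd_on :: "'a::chilbert_space set \<Rightarrow> ('a \<Rightarrow> 'a) \<Rightarrow> bool"
  where "psd_on M A \<longleftrightarrow> bounded_op_on M M A \<and> (\<forall>x\<in>M. 0 \<le> inner (A x) x) \<and>
    (\<forall>x\<in>M. \<forall>y\<in>M. inner (A x) y = inner x (A y))"

lemma psd_onD:
  assumes "psd_on M A"
  shows psd_on_bounded: "bounded_op_on M M A"
    and psd_on_nonneg: "x \<in> M \<Longrightarrow> 0 \<le> inner (A x) x"
    and psd_on_sym: "x \<in> M \<Longrightarrow> y \<in> M \<Longrightarrow> inner (A x) y = inner x (A y)"
  using assms by (auto simp: psd_on_def)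

text \<open>Complex positivity asks that \<open>cinner (A x) x\<close> be real as well as
  nonnegative; being real for all \<open>x\<close> amounts to symmetry of \<open>A\<close>.\<close>

lemma psd_on_iff:
  assumes M: "csubspace M"
  shows "psd_on M A \<longleftrightarrow> bounded_op_on M M A \<and> positive_on M A"
proof (cases "bounded_op_on M M A")
  case A: True
  note [simp] = csubspace_scaleC[OF M] csubspace_add[OF M]
    bounded_op_on_add[OF M A] bounded_op_on_scaleC[OF M A]
  have pos: "positive_on M A \<longleftrightarrow>
      (\<forall>x\<in>M. 0 \<le> inner (A x) x \<and> inner (\<i> *\<^sub>C A x) x = 0)"
    by (simp add: positive_on_def complex_nonneg_Reals_iff cinner_eq_Complex)
  have "(\<forall>x\<in>M. inner (\<i> *\<^sub>C A x) x = 0) \<longleftrightarrow> (\<forall>x\<in>M. \<forall>y\<in>M. inner (A x) y = inner x (A y))"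
  proof (intro iffI ballI)
    fix x y assume 0: "\<forall>x\<in>M. inner (\<i> *\<^sub>C A x) x = 0" and xy: "x \<in> M" "y \<in> M"
    \<comment> \<open>Polarisation, then \<open>x\<close> is replaced by \<open>- \<i> x\<close>.\<close>
    have "inner (\<i> *\<^sub>C A x) y + inner (\<i> *\<^sub>C A y) x = 0" if "x \<in> M" for x
      using bspec[OF 0, of "x + y"] 0 that xy by (simp add: scaleC_add_right inner_simps)
    from this[of "(- \<i>) *\<^sub>C x"] xy show "inner (A x) y = inner x (A y)"
      by (simp add: scaleC_scaleC inner_scaleC_left inner_commute scaleC_minus_left scaleC_minus_right
          bounded_op_on_minus[OF M A] csubspace_minus[OF M])
  next
    fix x assume sym: "\<forall>x\<in>M. \<forall>y\<in>M. inner (A x) y = inner x (A y)" and x: "x \<in> M"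
    have "inner (\<i> *\<^sub>C A x) x = inner (\<i> *\<^sub>C x) (A x)"
      using bspec[OF bspec[OF sym, of "\<i> *\<^sub>C x"], of x] x by simp
    also have "\<dots> = - inner (\<i> *\<^sub>C A x) x"
      using inner_scaleC_left[of \<i> x "A x"] by (simp add: inner_commute scaleC_minus_left)
    finally show "inner (\<i> *\<^sub>C A x) x = 0" by simp
  qed
  then show ?thesis
    using A pos by (auto simp: psd_on_def)
qed (simp add: psd_on_def)

lemma psd_on_cong:
  assumes M: "csubspace M" and eq: "\<And>x. x \<in> M \<Longrightarrow> A x = B x"
  shows "psd_on M A \<longleftrightarrow> psd_on M B"
  using eq csubspace_add[OF M] csubspace_scaleC[OF M]
  by (simp add: psd_on_def bounded_op_on_def)

text \<open>In the order of forms this is \<open>A^2 \<le> c A\<close>. It comes from expanding the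
  nonnegative form of \<open>A\<close> at \<open>c *\<^sub>R x - A x\<close> and estimating the
  cubic term by the norm bound.\<close>

lemma psd_on_norm_le:
  assumes M: "csubspace M" and A: "psd_on M A" and c: "0 < c"
    and bound: "\<And>x. x \<in> M \<Longrightarrow> norm (A x) \<le> c * norm x" and x: "x \<in> M"
  shows "(norm (A x))\<^sup>2 \<le> c * inner (A x) x"
proof -
  note bA = psd_on_bounded[OF A]
  have Ax: "A x \<in> M" using bounded_op_onD(1)[OF M bA] x by blast
  have "inner (A (A x)) (A x) \<le> norm (A (A x)) * norm (A x)"
    by (rule norm_cauchy_schwarz)
  also have "\<dots> \<le> c * norm (A x) * norm (A x)"
    using bound[OF Ax] by (rule mult_right_mono) simp
  finally have AA: "inner (A (A x)) (A x) \<le> c * (norm (A x))\<^sup>2"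
    by (simp add: power2_eq_square)
  have "0 \<le> inner (A (c *\<^sub>R x - A x)) (c *\<^sub>R x - A x)"
    by (intro psd_on_nonneg[OF A] csubspace_diff[OF M] csubspace_scaleR[OF M] x Ax)
  also have "\<dots> = c\<^sup>2 * inner (A x) x - 2 * c * (norm (A x))\<^sup>2 + inner (A (A x)) (A x)"
    by (simp add: bounded_op_on_diff[OF M bA] bounded_op_on_scaleR[OF M bA] csubspace_scaleR[OF M] x Ax
        inner_simps psd_on_sym[OF A Ax x] dot_square_norm power2_eq_square algebra_simps)
  finally have "c * (norm (A x))\<^sup>2 \<le> c * (c * inner (A x) x)"
    using AA by (simp add: power2_eq_square)
  then show ?thesis
    using c by simp
qed

section \<open>Existence and uniqueness of the positive square root\<close>

text \<open>
  The iterates converge to a solution of \<open>2 Z = X + Z\<^sup>2\<close>, that is \<open>(I - Z)\<^sup>2 = I - X\<close>. Their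
  differences are dominated by those of the same iteration for \<open>X = 1\<close>.
\<close>

primrec sqrt_iter :: "('a::chilbert_space \<Rightarrow> 'a) \<Rightarrow> nat \<Rightarrow> 'a \<Rightarrow> 'a"
  where "sqrt_iter X 0 = (\<lambda>x. 0)"
  | "sqrt_iter X (Suc n) = (\<lambda>x. (1/2) *\<^sub>R (X x + sqrt_iter X n (sqrt_iter X n x)))"

primrec sqrt_majorant :: "nat \<Rightarrow> real"
  where "sqrt_majorant 0 = 0"
  | "sqrt_majorant (Suc n) = (1 + (sqrt_majorant n)\<^sup>2) / 2"

lemma sqrt_majorant_bounds: "0 \<le> sqrt_majorant n \<and> sqrt_majorant n \<le> 1"
  by (induction n) (auto simp: power_le_one)

lemma sqrt_majorant_mono: "incseq sqrt_majorant"
proof (rule incseq_SucI)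
  fix n
  have "0 \<le> (1 - sqrt_majorant n)\<^sup>2" by simp
  then show "sqrt_majorant n \<le> sqrt_majorant (Suc n)"
    by (simp add: power2_diff)
qed

lemma Cauchy_sqrt_majorant: "Cauchy sqrt_majorant"
proof (rule incseq_convergent[OF sqrt_majorant_mono, of 1])
  show "Cauchy sqrt_majorant" if "sqrt_majorant \<longlonglongrightarrow> L" for L
    using that by (rule LIMSEQ_imp_Cauchy)
qed (use sqrt_majorant_bounds in blast)

context
  fixes M :: "'a::chilbert_space set" and X :: "'a \<Rightarrow> 'a"
  assumes M: "csubspace M" "closed M" and X: "bounded_op_on M M X"
    and contr: "\<And>x. x \<in> M \<Longrightarrow> norm (X x) \<le> norm x"
begin

lemma norm_sqrt_iter_le:
  "x \<in> M \<Longrightarrow> sqrt_iter X n x \<in> M \<and> norm (sqrt_iter X n x) \<le> sqrt_majorant n * norm x"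
proof (induction n arbitrary: x)
  case (Suc n)
  let ?Y = "sqrt_iter X n" and ?y = "sqrt_majorant n"
  have Y: "?Y x \<in> M" "?Y (?Y x) \<in> M" "X x \<in> M"
    using Suc bounded_op_onD(1)[OF M(1) X] by auto
  have "norm (?Y (?Y x)) \<le> ?y * norm (?Y x)"
    using Suc Y by blast
  also have "\<dots> \<le> ?y * (?y * norm x)"
    using Suc sqrt_majorant_bounds[of n] by (intro mult_left_mono) auto
  finally have "norm (X x + ?Y (?Y x)) \<le> (1 + ?y\<^sup>2) * norm x"
    using norm_triangle_ineq[of "X x" "?Y (?Y x)"] contr[OF Suc.prems]
    by (simp add: algebra_simps power2_eq_square)
  then show ?case
    using Y by (simp add: csubspace_scaleR[OF M(1)] csubspace_add[OF M(1)])
qed (simp add: csubspace_0[OF M(1)])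

lemmas sqrt_iter_in = conjunct1[OF norm_sqrt_iter_le]

lemma bounded_op_on_sqrt_iter: "bounded_op_on M M (sqrt_iter X n)"
proof (rule bounded_op_onI[where k = "sqrt_majorant n"])
  show "sqrt_iter X n (x + y) = sqrt_iter X n x + sqrt_iter X n y" if "x \<in> M" "y \<in> M" for x y
    using that
    by (induction n arbitrary: x y)
      (auto simp: bounded_op_on_add[OF M(1) X] sqrt_iter_in scaleR_add_right)
  show "sqrt_iter X n (c *\<^sub>C x) = c *\<^sub>C sqrt_iter X n x" if "x \<in> M" for c x
    using that
    by (induction n arbitrary: x)
      (auto simp: bounded_op_on_scaleC[OF M(1) X] sqrt_iter_in scaleC_scaleR scaleC_add_right)
qed (use norm_sqrt_iter_le in auto)

lemma sqrt_iter_sym: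
  assumes "\<And>x y. x \<in> M \<Longrightarrow> y \<in> M \<Longrightarrow> inner (X x) y = inner x (X y)" "x \<in> M" "y \<in> M"
  shows "inner (sqrt_iter X n x) y = inner x (sqrt_iter X n y)"
  using assms(2,3)
  by (induction n arbitrary: x y) (auto simp: inner_simps assms(1) sqrt_iter_in)

text \<open>Each iterate is a polynomial in \<open>X\<close>. The commutation survives in the limit
  and is what makes the square root unique.\<close>

lemma sqrt_iter_commute:
  assumes C: "bounded_op_on M M C" "\<And>x. x \<in> M \<Longrightarrow> C (X x) = X (C x)" and "x \<in> M"
  shows "C (sqrt_iter X n x) = sqrt_iter X n (C x)"
  using assms(3)
proof (induction n arbitrary: x)
  case (Suc n)
  have "X x \<in> M" "C x \<in> M"
    using Suc.prems bounded_op_onD(1)[OF M(1)] C(1) X by blast+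
  with Suc show ?case
    by (simp add: bounded_op_on_scaleR[OF M(1) C(1)] bounded_op_on_add[OF M(1) C(1)] C(2)
        sqrt_iter_in csubspace_add[OF M(1)])
qed (simp add: bounded_op_on_zero[OF M(1) C(1)])

text \<open>Writing \<open>Y'^2 - Y^2\<close> as \<open>Y' (Y' - Y) + (Y' - Y) Y\<close> and
  estimating each factor by its scalar majorant gives \<open>y'^2 - y^2\<close>, twice the next
  increment of the majorant.\<close>

lemma norm_sqrt_iter_Suc_diff_le:
  "x \<in> M \<Longrightarrow> norm (sqrt_iter X (Suc n) x - sqrt_iter X n x) \<le>
    (sqrt_majorant (Suc n) - sqrt_majorant n) * norm x"
proof (induction n arbitrary: x)
  case 0
  then show ?case using contr by simp
next
  case (Suc n)
  define Y Y' y y' where defs: "Y = sqrt_iter X n" "Y' = sqrt_iter X (Suc n)"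
    "y = sqrt_majorant n" "y' = sqrt_majorant (Suc n)"
  have in_M: "Y x \<in> M" "Y' x \<in> M"
    using Suc.prems sqrt_iter_in unfolding defs by blast+
  have IH: "norm (Y' x - Y x) \<le> (y' - y) * norm x" if "x \<in> M" for x
    using Suc.IH[OF that] by (simp only: defs)
  have nY: "norm (Y x) \<le> y * norm x" and nY': "norm (Y' x) \<le> y' * norm x" if "x \<in> M" for x
    using norm_sqrt_iter_le[OF that] by (simp_all only: defs)
  have y: "0 \<le> y" "0 \<le> y'" "y \<le> y'"
    using sqrt_majorant_bounds incseq_SucD[OF sqrt_majorant_mono, of n] by (auto simp only: defs)
  have "Y' (Y' x) - Y (Y x) = Y' (Y' x - Y x) + (Y' (Y x) - Y (Y x))"
    using bounded_op_on_diff[OF M(1) bounded_op_on_sqrt_iter[of "Suc n"]] in_M by (simp only: defs) simp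
  also have "norm \<dots> \<le> y' * ((y' - y) * norm x) + (y' - y) * (y * norm x)"
  proof (rule norm_triangle_mono)
    have "norm (Y' (Y' x - Y x)) \<le> y' * norm (Y' x - Y x)"
      using nY' in_M csubspace_diff[OF M(1)] by blast
    also have "\<dots> \<le> y' * ((y' - y) * norm x)"
      using IH[OF Suc.prems] y(2) by (rule mult_left_mono)
    finally show "norm (Y' (Y' x - Y x)) \<le> y' * ((y' - y) * norm x)" .
    have "norm (Y' (Y x) - Y (Y x)) \<le> (y' - y) * norm (Y x)"
      using IH in_M by blast
    also have "\<dots> \<le> (y' - y) * (y * norm x)"
      using nY[OF Suc.prems] y by (intro mult_left_mono) auto
    finally show "norm (Y' (Y x) - Y (Y x)) \<le> (y' - y) * (y * norm x)" .
  qed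
  also have "\<dots> = (y'\<^sup>2 - y\<^sup>2) * norm x"
    by (simp add: power2_eq_square algebra_simps)
  finally have *: "norm (Y' (Y' x) - Y (Y x)) / 2 \<le> (y'\<^sup>2 - y\<^sup>2) * norm x / 2"
    by simp
  have "sqrt_iter X (Suc (Suc n)) x - sqrt_iter X (Suc n) x
      = (1/2) *\<^sub>R (X x + Y' (Y' x)) - (1/2) *\<^sub>R (X x + Y (Y x))"
    unfolding defs by (simp only: sqrt_iter.simps)
  also have "\<dots> = (1/2) *\<^sub>R (Y' (Y' x) - Y (Y x))"
    by (simp only: scaleR_diff_right[symmetric]) simp
  finally have l: "sqrt_iter X (Suc (Suc n)) x - sqrt_iter X (Suc n) x =
      (1/2) *\<^sub>R (Y' (Y' x) - Y (Y x))" .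
  have "sqrt_majorant (Suc (Suc n)) - sqrt_majorant (Suc n) = (1 + y'\<^sup>2) / 2 - (1 + y\<^sup>2) / 2"
    unfolding defs by (simp only: sqrt_majorant.simps)
  then have r: "sqrt_majorant (Suc (Suc n)) - sqrt_majorant (Suc n) = (y'\<^sup>2 - y\<^sup>2) / 2"
    by (simp add: field_simps)
  show ?case
    unfolding l r using * by simp
qed

lemma norm_sqrt_iter_diff_le:
  assumes "x \<in> M" "m \<le> n"
  shows "norm (sqrt_iter X n x - sqrt_iter X m x) \<le> (sqrt_majorant n - sqrt_majorant m) * norm x"
  using assms(2)
proof (induction n rule: dec_induct)
  case (step n)
  have "norm (sqrt_iter X (Suc n) x - sqrt_iter X m x) \<le>
      norm (sqrt_iter X (Suc n) x - sqrt_iter X n x) + norm (sqrt_iter X n x - sqrt_iter X m x)"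
    by (rule norm_diff_triangle_le[OF order_refl order_refl])
  with step.IH norm_sqrt_iter_Suc_diff_le[OF assms(1), of n] show ?case
    by (simp only: left_diff_distrib)
qed simp

lemma sqrt_iter_limit:
  obtains Z where "\<And>x. x \<in> M \<Longrightarrow> (\<lambda>n. sqrt_iter X n x) \<longlonglongrightarrow> Z x"
proof -
  have "convergent (\<lambda>n. sqrt_iter X n x)" if x: "x \<in> M" for x
  proof -
    have "Cauchy (\<lambda>n. sqrt_iter X n x)"
      unfolding Cauchy_iff
    proof (intro allI impI)
      fix e :: real assume "e > 0"
      \<comment> \<open>A strictly positive bound for \<open>norm x\<close>, so that
        \<open>e / k\<close> makes sense also for \<open>x = 0\<close>.\<close>
      define k where "k = norm x + 1"
      have k: "k > 0" "norm x \<le> k" by (simp_all add: k_def add_nonneg_pos)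
      then obtain n0 where n0: "\<And>m n. m \<ge> n0 \<Longrightarrow> n \<ge> n0 \<Longrightarrow>
          norm (sqrt_majorant m - sqrt_majorant n) < e / k"
        using Cauchy_sqrt_majorant \<open>e > 0\<close> unfolding Cauchy_iff by (metis divide_pos_pos)
      have le: "norm (sqrt_iter X n x - sqrt_iter X m x) < e" if "n0 \<le> m" "m \<le> n" for m n
      proof -
        have "norm (sqrt_iter X n x - sqrt_iter X m x) \<le> (sqrt_majorant n - sqrt_majorant m) * norm x"
          by (rule norm_sqrt_iter_diff_le[OF x that(2)])
        also have "\<dots> \<le> (sqrt_majorant n - sqrt_majorant m) * k"
          using k(2) incseqD[OF sqrt_majorant_mono that(2)] by (intro mult_left_mono) auto
        also have "\<dots> < e"
          using n0[of n m] that k(1) incseqD[OF sqrt_majorant_mono that(2)]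
          by (simp add: pos_less_divide_eq)
        finally show ?thesis .
      qed
      then have "norm (sqrt_iter X m x - sqrt_iter X n x) < e" if "n0 \<le> m" "n0 \<le> n" for m n
        using that by (metis nle_le norm_minus_commute)
      then show "\<exists>n0. \<forall>m\<ge>n0. \<forall>n\<ge>n0. norm (sqrt_iter X m x - sqrt_iter X n x) < e"
        by blast
    qed
    then show ?thesis
      by (simp add: Cauchy_convergent_iff)
  qed
  then show thesis
    using that[of "\<lambda>x. lim (\<lambda>n. sqrt_iter X n x)"] by (simp add: convergent_LIMSEQ_iff)
qed

text \<open>Algebraic identities and bounds pass to the pointwise limit. The commutation clause is
  quantified over all \<open>C\<close>, since the operators to be compared with the root are chosen
  only later.\<close>

lemma sqrt_iter_limit_props:
  assumes sym: "\<And>x y. x \<in> M \<Longrightarrow> y \<in> M \<Longrightarrow> inner (X x) y = inner x (X y)"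
  obtains Z where "bounded_op_on M M Z" "\<And>x. x \<in> M \<Longrightarrow> norm (Z x) \<le> norm x"
    "\<And>x y. x \<in> M \<Longrightarrow> y \<in> M \<Longrightarrow> inner (Z x) y = inner x (Z y)"
    "\<And>x. x \<in> M \<Longrightarrow> Z x = (1/2) *\<^sub>R (X x + Z (Z x))"
    "\<forall>C. bounded_op_on M M C \<longrightarrow> (\<forall>x\<in>M. C (X x) = X (C x)) \<longrightarrow> (\<forall>x\<in>M. C (Z x) = Z (C x))"
proof -
  obtain Z where Z: "\<And>x. x \<in> M \<Longrightarrow> (\<lambda>n. sqrt_iter X n x) \<longlonglongrightarrow> Z x"
    using sqrt_iter_limit by blast
  have in_M: "Z x \<in> M" if "x \<in> M" for x
    using closed_sequentially[OF M(2) _ Z[OF that]] sqrt_iter_in[OF that] by blast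
  have iter_le: "norm (sqrt_iter X n x) \<le> norm x" if "x \<in> M" for n x
  proof -
    have "sqrt_majorant n * norm x \<le> 1 * norm x"
      using sqrt_majorant_bounds[of n] by (intro mult_right_mono) auto
    then show ?thesis
      using norm_sqrt_iter_le[OF that, of n] by simp
  qed
  have norm_le: "norm (Z x) \<le> norm x" if "x \<in> M" for x
    by (rule Lim_norm_ubound[OF _ Z[OF that]]) (auto intro: always_eventually iter_le[OF that])
  \<comment> \<open>Pointwise convergence alone does not control a composition; the uniform bound
    \<open>iter_le\<close> on the iterates does.\<close>
  have iter2: "(\<lambda>n. sqrt_iter X n (sqrt_iter X n x)) \<longlonglongrightarrow> Z (Z x)" if x: "x \<in> M" for x
  proof -
    have "(\<lambda>n. sqrt_iter X n (sqrt_iter X n x - Z x)) \<longlonglongrightarrow> 0"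
    proof (rule Lim_null_comparison)
      show "(\<lambda>n. norm (sqrt_iter X n x - Z x)) \<longlonglongrightarrow> 0"
        by (intro tendsto_norm_zero LIM_zero Z x)
      show "\<forall>\<^sub>F n in sequentially. norm (sqrt_iter X n (sqrt_iter X n x - Z x)) \<le> norm (sqrt_iter X n x - Z x)"
        by (intro always_eventually allI iter_le csubspace_diff[OF M(1)] sqrt_iter_in in_M x)
    qed
    from tendsto_add[OF this Z[OF in_M[OF x]]] show ?thesis
      by (simp add: bounded_op_on_diff[OF M(1) bounded_op_on_sqrt_iter] sqrt_iter_in in_M x)
  qed
  show thesis
  proof
    show "bounded_op_on M M Z"
    proof (rule bounded_op_onI[where k = 1])
      fix x y c assume x: "x \<in> M"
      show "Z (c *\<^sub>C x) = c *\<^sub>C Z x"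
        using Z[OF csubspace_scaleC[OF M(1) x, of c]] tendsto_scaleC[OF Z[OF x], of c]
        by (simp add: bounded_op_on_scaleC[OF M(1) bounded_op_on_sqrt_iter] x LIMSEQ_unique)
      assume y: "y \<in> M"
      show "Z (x + y) = Z x + Z y"
        using Z[OF csubspace_add[OF M(1) x y]] tendsto_add[OF Z[OF x] Z[OF y]]
        by (simp add: bounded_op_on_add[OF M(1) bounded_op_on_sqrt_iter] x y LIMSEQ_unique)
    qed (use norm_le in_M in auto)
    show "inner (Z x) y = inner x (Z y)" if "x \<in> M" "y \<in> M" for x y
    proof (rule LIMSEQ_unique)
      show "(\<lambda>n. inner (sqrt_iter X n x) y) \<longlonglongrightarrow> inner (Z x) y"
        by (rule tendsto_inner[OF Z[OF that(1)] tendsto_const])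
      show "(\<lambda>n. inner (sqrt_iter X n x) y) \<longlonglongrightarrow> inner x (Z y)"
        using tendsto_inner[OF tendsto_const Z[OF that(2)], of x]
        by (simp add: sqrt_iter_sym sym that)
    qed
    show "Z x = (1/2) *\<^sub>R (X x + Z (Z x))" if "x \<in> M" for x
    proof (rule LIMSEQ_unique)
      show "(\<lambda>n. sqrt_iter X (Suc n) x) \<longlonglongrightarrow> Z x"
        by (rule LIMSEQ_Suc[OF Z[OF that]])
      show "(\<lambda>n. sqrt_iter X (Suc n) x) \<longlonglongrightarrow> (1/2) *\<^sub>R (X x + Z (Z x))"
        unfolding sqrt_iter.simps by (intro tendsto_intros iter2 that)
    qed
    have "C (Z x) = Z (C x)" if C: "bounded_op_on M M C" "\<And>x. x \<in> M \<Longrightarrow> C (X x) = X (C x)"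
      and x: "x \<in> M" for C x
    proof (rule LIMSEQ_unique)
      show "(\<lambda>n. C (sqrt_iter X n x)) \<longlonglongrightarrow> C (Z x)"
        by (rule bounded_op_on_tendsto[OF M(1) C(1) _ _ Z[OF x]]) (auto intro: sqrt_iter_in in_M x)
      show "(\<lambda>n. C (sqrt_iter X n x)) \<longlonglongrightarrow> Z (C x)"
        using Z[OF bounded_op_onD(1)[OF M(1) C(1) x]] by (simp add: sqrt_iter_commute C x)
    qed
    then show "\<forall>C. bounded_op_on M M C \<longrightarrow> (\<forall>x\<in>M. C (X x) = X (C x)) \<longrightarrow>
        (\<forall>x\<in>M. C (Z x) = Z (C x))"
      by blast
  qed (use norm_le in auto)
qed

end


text \<open>For a bound \<open>c\<close> of \<open>A\<close> the operator
  \<open>X = I - A / c\<close> is a contraction. The iteration gives \<open>Z\<close> with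
  \<open>(I - Z)^2 = I - X = A / c\<close>, and \<open>S\<close> is \<open>I - Z\<close> rescaled by
  \<open>sqrt c\<close>; it is positive because \<open>Z\<close> is a contraction.\<close>

lemma ex_psd_sqrt:
  assumes M: "csubspace M" "closed M" and A: "psd_on M A"
  obtains S where "psd_on M S" "\<And>x. x \<in> M \<Longrightarrow> S (S x) = A x"
    "\<forall>C. bounded_op_on M M C \<longrightarrow> (\<forall>x\<in>M. C (A x) = A (C x)) \<longrightarrow> (\<forall>x\<in>M. C (S x) = S (C x))"
proof -
  note bA = psd_on_bounded[OF A]
  obtain c where c: "c > 0" "\<And>x. x \<in> M \<Longrightarrow> norm (A x) \<le> c * norm x"
    using bounded_op_on_bound[OF M(1) bA] by blast
  have A_in: "A x \<in> M" if "x \<in> M" for x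
    using that bounded_op_onD(1)[OF M(1) bA] by blast
  note M_simps = csubspace_diff[OF M(1)] csubspace_scaleR[OF M(1)] csubspace_add[OF M(1)]
    csubspace_scaleC[OF M(1)]
  define X where "X x = x - (1/c) *\<^sub>R A x" for x
  have contr: "norm (X x) \<le> norm x" if x: "x \<in> M" for x
  proof -
    \<comment> \<open>By \<open>A^2 \<le> c A\<close> the quadratic term of
      \<open>norm (X x)\<close> squared takes back at most half of what the linear term
      removes.\<close>
    have "(norm (A x))\<^sup>2 / c\<^sup>2 \<le> inner (A x) x / c"
      using psd_on_norm_le[OF M(1) A c x] c(1) by (simp add: field_simps power2_eq_square)
    moreover have "(norm (X x))\<^sup>2 = (norm x)\<^sup>2 - 2 * (inner (A x) x / c) + (norm (A x))\<^sup>2 / c\<^sup>2"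
      unfolding power2_norm_eq_inner X_def inner_diff_left inner_diff_right inner_scaleR_left
        inner_scaleR_right inner_commute[of x "A x"]
      using c(1) by (simp add: power2_eq_square field_simps)
    moreover have "0 \<le> inner (A x) x / c"
      using psd_on_nonneg[OF A x] c(1) by simp
    ultimately have "(norm (X x))\<^sup>2 \<le> (norm x)\<^sup>2" by linarith
    then show ?thesis by simp
  qed
  have bX: "bounded_op_on M M X"
    by (rule bounded_op_onI[where k = 1])
      (use contr in \<open>auto simp: X_def M_simps A_in bounded_op_on_add[OF M(1) bA]
        bounded_op_on_scaleC[OF M(1) bA] scaleC_diff_right scaleC_scaleR scaleR_add_right\<close>)
  have symX: "inner (X x) y = inner x (X y)" if "x \<in> M" "y \<in> M" for x y
    using that by (simp add: X_def inner_simps psd_on_sym[OF A])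
  obtain Z where Z: "bounded_op_on M M Z" "\<And>x. x \<in> M \<Longrightarrow> norm (Z x) \<le> norm x"
    "\<And>x y. x \<in> M \<Longrightarrow> y \<in> M \<Longrightarrow> inner (Z x) y = inner x (Z y)"
    "\<And>x. x \<in> M \<Longrightarrow> Z x = (1/2) *\<^sub>R (X x + Z (Z x))"
    "\<forall>C. bounded_op_on M M C \<longrightarrow> (\<forall>x\<in>M. C (X x) = X (C x)) \<longrightarrow> (\<forall>x\<in>M. C (Z x) = Z (C x))"
    by (rule sqrt_iter_limit_props[OF M bX], erule contr, erule (1) symX, rule that)
  have Z_in: "Z x \<in> M" if "x \<in> M" for x
    using that bounded_op_onD(1)[OF M(1) Z(1)] by blast
  note Z_simps = bounded_op_on_add[OF M(1) Z(1)] bounded_op_on_diff[OF M(1) Z(1)]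
    bounded_op_on_scaleC[OF M(1) Z(1)] bounded_op_on_scaleR[OF M(1) Z(1)]
  define S where "S x = sqrt c *\<^sub>R (x - Z x)" for x
  have S_norm: "norm (S x) \<le> (sqrt c * 2) * norm x" if "x \<in> M" for x
  proof -
    have "norm (x - Z x) \<le> 2 * norm x"
      using norm_triangle_ineq4[of x "Z x"] Z(2)[OF that] by linarith
    then show ?thesis
      using c(1) by (simp add: S_def)
  qed
  show thesis
  proof
    have "bounded_op_on M M S"
      by (rule bounded_op_onI[where k = "sqrt c * 2"])
        (use S_norm in \<open>auto simp: S_def M_simps Z_in Z_simps scaleC_diff_right scaleC_scaleR
          algebra_simps\<close>)
    moreover have "0 \<le> inner (S x) x" if "x \<in> M" for x
    proof -
      have "inner (Z x) x \<le> norm (Z x) * norm x"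
        by (rule norm_cauchy_schwarz)
      also have "\<dots> \<le> norm x * norm x"
        using Z(2)[OF that] by (rule mult_right_mono) simp
      finally show ?thesis
        using c(1) by (simp add: S_def inner_diff_left dot_square_norm power2_eq_square)
    qed
    moreover have "inner (S x) y = inner x (S y)" if "x \<in> M" "y \<in> M" for x y
      using that by (simp add: S_def inner_simps Z(3))
    ultimately show "psd_on M S"
      by (simp add: psd_on_def)
    show "S (S x) = A x" if "x \<in> M" for x
    proof -
      have "2 *\<^sub>R Z x = X x + Z (Z x)"
        by (subst Z(4)[OF that]) simp
      then have *: "Z (Z x) = 2 *\<^sub>R Z x - X x" by simp
      have "S (S x) = (sqrt c * sqrt c) *\<^sub>R (x - Z x - (Z x - Z (Z x)))"
        using that by (simp add: S_def Z_simps M_simps Z_in scaleR_diff_right)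
      also have "x - Z x - (Z x - Z (Z x)) = (1/c) *\<^sub>R A x"
        unfolding * X_def by (simp add: scaleR_2)
      finally show ?thesis
        using c(1) by simp
    qed
    have "C (S x) = S (C x)" if C: "bounded_op_on M M C" "\<And>x. x \<in> M \<Longrightarrow> C (A x) = A (C x)"
      and x: "x \<in> M" for C x
    proof -
      have "C (X x) = X (C x)" if "x \<in> M" for x
        using that by (simp add: X_def bounded_op_on_diff[OF M(1) C(1)] M_simps A_in
            bounded_op_on_scaleR[OF M(1) C(1)] C(2))
      then have "C (Z x) = Z (C x)"
        using Z(5) C(1) x by blast
      then show ?thesis
        using x by (simp add: S_def bounded_op_on_diff[OF M(1) C(1)] M_simps Z_in
            bounded_op_on_scaleR[OF M(1) C(1)])
    qed
    then show "\<forall>C. bounded_op_on M M C \<longrightarrow> (\<forall>x\<in>M. C (A x) = A (C x)) \<longrightarrow>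
        (\<forall>x\<in>M. C (S x) = S (C x))"
      by blast
  qed
qed

lemma psd_on_eq_0I:
  assumes M: "csubspace M" and A: "psd_on M A" and x: "x \<in> M" "inner (A x) x = 0"
  shows "A x = 0"
proof -
  obtain c where "c > 0" "\<And>x. x \<in> M \<Longrightarrow> norm (A x) \<le> c * norm x"
    using bounded_op_on_bound[OF M psd_on_bounded[OF A]] by blast
  from psd_on_norm_le[OF M A this x(1)] x(2) show ?thesis
    by simp
qed

text \<open>The constructed root \<open>S\<close> commutes with every root \<open>B\<close>, because \<open>B\<close> commutes with \<open>B\<^sup>2\<close>;
  so \<open>(S + B) (S - B) = 0\<close>.\<close>

lemma psd_sqrt_unique:
  assumes M: "csubspace M" "closed M" and A: "psd_on M A"
    and B: "psd_on M B" "\<And>x. x \<in> M \<Longrightarrow> B (B x) = A x"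
    and B': "psd_on M B'" "\<And>x. x \<in> M \<Longrightarrow> B' (B' x) = A x" and x: "x \<in> M"
  shows "B x = B' x"
proof -
  obtain S where S: "psd_on M S" "\<And>x. x \<in> M \<Longrightarrow> S (S x) = A x"
    "\<forall>C. bounded_op_on M M C \<longrightarrow> (\<forall>x\<in>M. C (A x) = A (C x)) \<longrightarrow> (\<forall>x\<in>M. C (S x) = S (C x))"
    by (rule ex_psd_sqrt[OF M A], rule that)
  have "C x = S x" if C: "psd_on M C" "\<And>x. x \<in> M \<Longrightarrow> C (C x) = A x" for C
  proof -
    note bS = psd_on_bounded[OF S(1)] and bC = psd_on_bounded[OF C(1)]
    have in_M: "S y \<in> M" "C y \<in> M" if "y \<in> M" for y
      using that bounded_op_onD(1)[OF M(1)] bS bC by blast+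
    have "C (A y) = A (C y)" if "y \<in> M" for y
      using C(2)[OF that] C(2)[OF in_M(2)[OF that]] by simp
    then have comm: "C (S y) = S (C y)" if "y \<in> M" for y
      using S(3) bC that by blast
    define y where "y = S x - C x"
    have y: "y \<in> M"
      unfolding y_def using in_M x csubspace_diff[OF M(1)] by blast
    \<comment> \<open>Since \<open>C\<close> and \<open>S\<close> commute, the left side is the
      difference of the two squares at \<open>x\<close>. The sum of two nonnegative forms at
      \<open>y\<close> then vanishes, so both do.\<close>
    have "S y + C y = 0"
      unfolding y_def using in_M x
      by (simp add: bounded_op_on_diff[OF M(1)  bS] bounded_op_on_diff[OF M(1) bC] S(2) C(2) comm)
    then have "inner (S y) y + inner (C y) y = 0"
      by (simp add: inner_add_left[symmetric])
    then have "inner (S y) y = 0" "inner (C y) y = 0"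
      using psd_on_nonneg[OF S(1) y] psd_on_nonneg[OF C(1) y] by linarith+
    then have "S y = 0" "C y = 0"
      using psd_on_eq_0I[OF M(1)] S(1) C(1) y by blast+
    moreover have "inner y y = inner (S x - C x) y"
      by (simp add: y_def)
    then have "inner y y = inner x (S y) - inner x (C y)"
      by (simp add: inner_diff_left psd_on_sym[OF S(1) x y] psd_on_sym[OF C(1) x y])
    ultimately show ?thesis
      by (simp add: y_def)
  qed
  from this[OF B] this[OF B'] show ?thesis by simp
qed

section \<open>Square roots and defect operators as defined by \<open>sqrt_on\<close>\<close>

text \<open>Uniqueness holds only on \<open>M\<close>; cutting the root off to \<open>0\<close>
  outside \<open>M\<close> makes it unique as a function, so that the definite description denotes
  it.\<close>

lemma sqrt_on_psd:
  assumes M: "csubspace M" "closed M" and A: "psd_on M A"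
  shows psd_on_sqrt_on: "psd_on M (sqrt_on M A)"
    and sqrt_on_sqrt_on: "x \<in> M \<Longrightarrow> sqrt_on M A (sqrt_on M A x) = A x"
proof -
  let ?P = "\<lambda>B. bounded_op_on M M B \<and> positive_on M B \<and>
    (\<forall>x\<in>M. B (B x) = A x) \<and> (\<forall>x. x \<notin> M \<longrightarrow> B x = 0)"
  obtain S where S: "psd_on M S" "\<And>x. x \<in> M \<Longrightarrow> S (S x) = A x"
    by (rule ex_psd_sqrt[OF M A], rule that)
  define B where "B x = (if x \<in> M then S x else 0)" for x
  have "psd_on M B"
    using S(1) psd_on_cong[OF M(1), of B S] by (simp add: B_def)
  moreover have "B (B x) = A x" if "x \<in> M" for x
    using that S(2) bounded_op_onD(1)[OF M(1) psd_on_bounded[OF S(1)]] by (simp add: B_def)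
  ultimately have "?P B"
    using psd_on_iff[OF M(1)] by (auto simp: B_def)
  moreover have "C = B" if "?P C" for C
  proof
    fix x
    show "C x = B x"
    proof (cases "x \<in> M")
      case True
      with psd_sqrt_unique[OF M A _ _ _ _ True, of C B] that \<open>?P B\<close> psd_on_iff[OF M(1)]
      show ?thesis by blast
    qed (use that \<open>?P B\<close> in auto)
  qed
  ultimately have "?P (sqrt_on M A)"
    unfolding sqrt_on_def by (rule theI)
  then show "psd_on M (sqrt_on M A)" "x \<in> M \<Longrightarrow> sqrt_on M A (sqrt_on M A x) = A x"
    using psd_on_iff[OF M(1)] by auto
qed

text \<open>Positivity and the norm identity are all that is used later about defect operators. The
  identity is the quadratic form of \<open>I\<close> minus the adjoint of \<open>G\<close> times
  \<open>G\<close>, the square of the defect operator.\<close>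

lemma defect_op_contraction:
  assumes M: "csubspace M" "closed M" and N: "csubspace N" and G: "contraction_on M N G"
  shows psd_on_defect_op: "psd_on M (defect_op M G)"
    and norm_defect_op: "x \<in> M \<Longrightarrow> (norm (defect_op M G x))\<^sup>2 = (norm x)\<^sup>2 - (norm (G x))\<^sup>2"
proof -
  have bG: "bounded_op_on M N G" and le: "\<And>x. x \<in> M \<Longrightarrow> norm (G x) \<le> norm x"
    using G contraction_on_iff[OF M(1)] by auto
  have G_in: "G x \<in> N" if "x \<in> M" for x
    using that bounded_op_onD(1)[OF M(1) bG] by blast
  note adj_in = adjoint_on_in[OF M N bG] and adj = adjoint_on_inner[OF M N bG]
    and bH = bounded_op_on_adjoint[OF M N bG]
  have adj': "inner (adjoint_on M G y) x = inner y (G x)" if "x \<in> M" for x y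
    using adj[OF that] by (simp add: inner_commute)
  let ?A = "\<lambda>x. x - adjoint_on M G (G x)"
  have A_inner: "inner (?A x) x = (norm x)\<^sup>2 - (norm (G x))\<^sup>2" if "x \<in> M" for x
    using that by (simp add: inner_diff_left adj' dot_square_norm)
  have psd: "psd_on M ?A"
    unfolding psd_on_def
  proof (intro conjI ballI)
    show "bounded_op_on M M ?A"
    proof (rule bounded_op_onI[where k = 2])
      fix x assume "x \<in> M"
      then have "norm (adjoint_on M G (G x)) \<le> norm x"
        using norm_adjoint_on_le[OF M N bG, of 1 "G x"] le by fastforce
      then show "norm (?A x) \<le> 2 * norm x"
        using norm_triangle_ineq4[of x "adjoint_on M G (G x)"] by linarith
    qed (auto simp: csubspace_diff[OF M(1)] adj_in G_in bounded_op_on_add[OF M(1) bG]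
        bounded_op_on_scaleC[OF M(1) bG] bounded_op_on_add[OF N bH] bounded_op_on_scaleC[OF N bH]
        scaleC_diff_right)
    show "0 \<le> inner (?A x) x" if "x \<in> M" for x
      using A_inner[OF that] le[OF that] by (simp add: power_mono)
    show "inner (?A x) y = inner x (?A y)" if "x \<in> M" "y \<in> M" for x y
      using that by (simp add: inner_simps adj' adj[symmetric])
  qed
  show D: "psd_on M (defect_op M G)"
    unfolding defect_op_def by (rule psd_on_sqrt_on[OF M psd])
  show "(norm (defect_op M G x))\<^sup>2 = (norm x)\<^sup>2 - (norm (G x))\<^sup>2" if x: "x \<in> M"
  proof -
    let ?D = "defect_op M G"
    have "?D x \<in> M"
      using bounded_op_onD(1)[OF M(1) psd_on_bounded[OF D]] x by blast
    then have "(norm (?D x))\<^sup>2 = inner (?D (?D x)) x"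
      using psd_on_sym[OF D _ x] by (simp add: power2_norm_eq_inner)
    also have "\<dots> = inner (?A x) x"
      using sqrt_on_sqrt_on[OF M psd x] by (simp add: defect_op_def)
    finally show ?thesis
      by (simp add: A_inner[OF x])
  qed
qed

text \<open>The contractions are stated on the closed range of \<open>T 0\<close>, while the
  factorization produces them on that of its root. A vector orthogonal to the range of
  \<open>A\<close> is killed by \<open>A\<close>, hence by the root, hence orthogonal to the range
  of the root.\<close>

lemma closure_range_sqrt_op:
  assumes A: "psd_on UNIV A"
  shows "closure (range (sqrt_op A)) = closure (range A)"
proof (rule antisym)
  let ?S = "sqrt_op A"
  have S: "psd_on UNIV ?S" and SS: "\<And>x. ?S (?S x) = A x"
    using psd_on_sqrt_on[OF csubspace_UNIV closed_UNIV A]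
      sqrt_on_sqrt_on[OF csubspace_UNIV closed_UNIV A] by auto
  show "closure (range A) \<subseteq> closure (range ?S)"
    by (rule closure_mono) (auto simp: SS[symmetric])
  have "?S x \<in> closure (range A)" for x
  proof -
    let ?c = "norm (?S x)"
    note bA = psd_on_bounded[OF A]
    have cs: "csubspace (range A)"
      by (rule csubspace_image[OF csubspace_UNIV bA])
    \<comment> \<open>The Riesz lemma along the identity serves as orthogonal projection of
      \<open>?S x\<close> onto the closed range of \<open>A\<close>; the remainder \<open>w\<close>
      will turn out to be zero.\<close>
    have "\<exists>g. g \<in> closure (id ` range A) \<and> (\<forall>y\<in>range A. inner y (?S x) = inner (id y) g) \<and>
        norm g \<le> norm (?S x)"
      by (rule Riesz_along_map[OF cs])
        (auto intro!: bounded_op_onI[where k = 1] simp: inner_add_left,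
          metis Cauchy_Schwarz_ineq2 mult.commute)
    then obtain g where g: "g \<in> closure (range A)" "\<And>y. inner (A y) (?S x) = inner (A y) g"
      by auto
    define w where "w = ?S x - g"
    have "inner (A y) w = 0" for y
      by (simp add: w_def inner_diff_right g(2))
    then have "inner (A w) y = 0" for y
      using psd_on_sym[OF A, of w y] by (simp add: inner_commute)
    then have "A w = 0" 
      using inner_eq_zero_iff by blast
    have "inner (?S w) (?S w) = inner (?S (?S w)) w"
      using psd_on_sym[OF S, of "?S w" w] by simp
    then have Sw: "?S w = 0"
      by (simp add: SS \<open>A w = 0\<close>)
    have "closure (range A) \<subseteq> {u. inner w u = 0}"
      using \<open>\<And>y. inner (A y) w = 0\<close>
      by (intro closure_minimal closed_hyperplane) (auto simp: inner_commute)
    with g(1) have "inner g w = 0" by (auto simp: inner_commute)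
    moreover have "inner (?S x) w = 0"
      using psd_on_sym[OF S, of x w] Sw by simp
    ultimately have "inner w w = 0"
      by (simp add: w_def inner_diff_left)
    then show ?thesis
      using g(1) by (simp add: w_def)
  qed
  then show "closure (range ?S) \<subseteq> closure (range A)"
    by (intro closure_minimal) auto
qed

section \<open>Quadratic forms and the block matrix\<close>

text \<open>The discriminant criterion, evaluated at the vertex \<open>- b / p^2\<close>; for
  \<open>p = 0\<close> the expression is affine and there is no vertex.\<close>

lemma abs_le_of_quadratic_nonneg:
  fixes b p q :: real
  assumes "0 \<le> p" "0 \<le> q" "\<And>t. 0 \<le> t\<^sup>2 * p\<^sup>2 + 2 * t * b + q\<^sup>2"
  shows "\<bar>b\<bar> \<le> p * q"
proof -
  have "b\<^sup>2 \<le> (p * q)\<^sup>2"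
  proof (cases "p = 0")
    case True
    have "b = 0"
    proof (rule ccontr)
      assume "b \<noteq> 0"
      \<comment> \<open>At this argument the affine expression takes the value -1.\<close>
      with assms(3)[of "- (q\<^sup>2 + 1) / (2 * b)"] True show False
        by (simp add: field_simps)
    qed
    then show ?thesis by simp
  next
    case False
    then have "(- b / p\<^sup>2)\<^sup>2 * p\<^sup>2 + 2 * (- b / p\<^sup>2) * b + q\<^sup>2 = q\<^sup>2 - b\<^sup>2 / p\<^sup>2"
      by (simp add: power_divide power2_eq_square)
    with assms(3)[of "- b / p\<^sup>2"] have "b\<^sup>2 / p\<^sup>2 \<le> q\<^sup>2"
      by simp
    with False show ?thesis
      by (simp add: pos_divide_le_eq power_mult_distrib mult.commute)
  qed
  then have "\<bar>b\<bar> \<le> \<bar>p * q\<bar>"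
    by (simp add: abs_le_square_iff)
  then show ?thesis
    using assms(1,2) by simp
qed


lemma bounded_op_block_op:
  assumes "bounded_op (T 0)" "bounded_op (T 1)"
  shows "bounded_op (block_op T)"
proof -
  note adj = bounded_op_on_adjoint[OF csubspace_UNIV closed_UNIV csubspace_UNIV assms(2)]
  note lin = assms[unfolded bounded_op_iff] adj[unfolded bounded_op_iff]
  have "bounded_linear (block_op T)"
    unfolding block_op_def case_prod_beta
    by (intro bounded_linear_Pair bounded_linear_add
        bounded_linear_compose[OF lin(1)[THEN conjunct1]]
        bounded_linear_compose[OF lin(2)[THEN conjunct1]]
        bounded_linear_compose[OF lin(3)[THEN conjunct1]]
        bounded_linear_fst bounded_linear_fst_comp bounded_linear_snd_comp bounded_linear_snd)
  then show ?thesis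
    using lin by (simp add: bounded_op_iff block_op_def case_prod_beta scaleC_prod_def scaleC_add_right)
qed

text \<open>Each entry \<open>T 1\<close> and the adjoint entry opposite to it contribute the same
  real number, whence the factor 2. Symmetry of \<open>T 0\<close> does not follow from the real
  form and is read off from vectors supported in the first coordinate.\<close>

lemma block_op_positive_iff:
  assumes A: "bounded_op (T 0)" and B: "bounded_op (T 1)"
  shows "positive_op (block_op T) \<longleftrightarrow> psd_on UNIV (T 0) \<and>
    (\<forall>x y z. 0 \<le> inner (T 0 x) x + inner (T 0 y) y + inner (T 0 z) z
      + 2 * (inner (T 1 y) x + inner (T 1 z) y + inner (T 1 x) z))"
    (is "_ \<longleftrightarrow> _ \<and> (\<forall>x y z. 0 \<le> ?F x y z)")
proof -
  note U = csubspace_UNIV closed_UNIV csubspace_UNIV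
  have adj: "inner (adjoint_op (T 1) y) x = inner (T 1 x) y" for x y
    using adjoint_on_inner[OF U B] by (simp add: inner_commute)
  have F: "inner (block_op T (x, y, z)) (x, y, z) = ?F x y z" for x y z
    by (simp add: block_op_def inner_add_left adj)
  have bounded: "bounded_op (block_op T)"
    by (rule bounded_op_block_op[of T, OF A B])
  then have iff: "positive_op (block_op T) \<longleftrightarrow> psd_on UNIV (block_op T)"
    using psd_on_iff[OF csubspace_UNIV, of "block_op T"] by simp
  show ?thesis
    unfolding iff
  proof safe
    assume P: "psd_on UNIV (block_op T)"
    show F0: "0 \<le> ?F x y z" for x y z
      using psd_on_nonneg[OF P, of "(x, y, z)"] by (simp add: F)
    have "inner (block_op T (x, 0, 0)) (y, 0, 0) = inner (x, 0, 0) (block_op T (y, 0, 0))" for x y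
      using psd_on_sym[OF P] by blast
    then have "inner (T 0 x) y = inner x (T 0 y)" for x y
      using bounded_op_on_zero[OF csubspace_UNIV A] bounded_op_on_zero[OF csubspace_UNIV B]
        bounded_op_on_zero[OF csubspace_UNIV bounded_op_on_adjoint[OF U B]]
      by (simp add: block_op_def)
    moreover have "0 \<le> inner (T 0 x) x" for x
      using F0[of x 0 0] bounded_op_on_zero[OF csubspace_UNIV A] bounded_op_on_zero[OF csubspace_UNIV B]
      by simp
    ultimately show "psd_on UNIV (T 0)"
      using A by (simp add: psd_on_def)
  next
    assume P: "psd_on UNIV (T 0)" and F0: "\<forall>x y z. 0 \<le> ?F x y z"
    have "inner (block_op T (x, y, z)) (x', y', z') = inner (x, y, z) (block_op T (x', y', z'))"
      for x y z x' y' z'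
      using psd_on_sym[OF P, of x x'] psd_on_sym[OF P, of y y'] psd_on_sym[OF P, of z z']
      by (simp add: block_op_def inner_add_left inner_add_right adj adjoint_on_inner[OF U B, symmetric])
        (simp add: inner_commute)
    then have "inner (block_op T p) q = inner p (block_op T q)" for p q
      by (cases p; cases q) blast
    moreover have "0 \<le> inner (block_op T p) p" for p
      using F F0 by (cases p) auto
    ultimately show "psd_on UNIV (block_op T)"
      using bounded by (simp add: psd_on_def)
  qed
qed

section \<open>Positive definiteness on the cyclic group of order three\<close>

lemma exhaust_3_from_0: "s = 0 \<or> s = 1 \<or> s = 2" for s :: 3
  using exhaust_3[of s] by auto

lemma sum_UNIV_3: "(\<Sum>s\<in>UNIV. f s) = f 0 + f 1 + f (2 :: 3)"
proof -
  have U: "(UNIV :: 3 set) = {0, 1, 2}"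
    using exhaust_3_from_0 by blast
  show ?thesis
    unfolding U by (simp add: add.assoc)
qed

text \<open>A function \<open>h\<close> on the group is a triple of vectors, and its double sum is
  the block form at that triple. The adjoint condition at 1 and 2 comes from \<open>T2\<close>; at 0
  it says that \<open>T 0\<close> is self-adjoint, which positivity of the block matrix
  supplies.\<close>

lemma positive_definite_fun_3_iff:
  fixes T :: "3 \<Rightarrow> 'a::chilbert_space \<Rightarrow> 'a"
  assumes A: "bounded_op (T 0)" and B: "bounded_op (T 1)" and T2: "T 2 = adjoint_op (T 1)"
  shows "positive_definite_fun T \<longleftrightarrow> positive_op (block_op T)"
proof -
  note U = csubspace_UNIV closed_UNIV csubspace_UNIV
  note bA = bounded_op_on_adjoint[OF U B]
  have T0: "T s 0 = 0" for s
    using bounded_op_on_zero[OF csubspace_UNIV A] bounded_op_on_zero[OF csubspace_UNIV B]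
      bounded_op_on_zero[OF csubspace_UNIV bA] T2 exhaust_3_from_0[of s] by auto
  have ci: "cinner x (0::'a) = 0" "cinner (0::'a) x = 0" for x
    by (simp_all add: cinner_eq_Complex zero_complex.code)
  have minus: "- (1 :: 3) = 2" "- (2 :: 3) = 1" "(2::3) + 2 = 1" "(2::3) + 1 = 0" "(1::3) + 2 = 0"
    "(1::3) + 1 = 2"
    by simp_all
  have sum: "(\<Sum>s | h s \<noteq> 0. \<Sum>t | h t \<noteq> 0. cinner (T (- t + s) (h s)) (h t)) =
      cinner (block_op T (h 0, h 1, h 2)) (h 0, h 1, h 2)" for h
  proof -
    \<comment> \<open>Summands outside the support vanish because every \<open>T s\<close> maps 0 to
      0.\<close>
    have "(\<Sum>s | h s \<noteq> 0. \<Sum>t | h t \<noteq> 0. cinner (T (- t + s) (h s)) (h t)) =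
        (\<Sum>s\<in>UNIV. \<Sum>t\<in>UNIV. cinner (T (- t + s) (h s)) (h t))"
      by (intro sum.mono_neutral_cong_left sum.mono_neutral_left) (auto simp: ci T0 intro: sum.neutral)
    also have "\<dots> = cinner (block_op T (h 0, h 1, h 2)) (h 0, h 1, h 2)"
      unfolding sum_UNIV_3 minus block_op_def cinner_prod_def T2[symmetric]
      by (simp add: cinner_add_left)
    finally show ?thesis .
  qed
  have adj2: "adjoint_op (adjoint_op (T 1)) = T 1"
    by (rule ext, rule adjoint_on_eqI[OF U bA])
      (use adjoint_on_inner[OF U B] in \<open>simp_all add: inner_commute\<close>)
  have adj0: "adjoint_op (T 0) = T 0" if "positive_op (block_op T)"
  proof -
    have "psd_on UNIV (T 0)"
      using that block_op_positive_iff[of T, OF A B] by blast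
    then show ?thesis
      by (intro ext adjoint_on_eqI[OF U A]) (simp_all add: psd_on_sym)
  qed
  have adj: "T (- s) = adjoint_op (T s)" if "positive_op (block_op T)" for s
  proof -
    consider "s = 0" | "s = 1" | "s = 2"
      using exhaust_3_from_0 by blast
    then show ?thesis
      by cases (simp_all add: adj0[OF that] adj2 T2 minus)
  qed
  have "(\<forall>h :: 3 \<Rightarrow> 'a. cinner (block_op T (h 0, h 1, h 2)) (h 0, h 1, h 2) \<in> \<real>\<^sub>\<ge>\<^sub>0) \<longleftrightarrow> positive_op (block_op T)"
  proof
    assume *: "\<forall>h :: 3 \<Rightarrow> 'a. cinner (block_op T (h 0, h 1, h 2)) (h 0, h 1, h 2) \<in> \<real>\<^sub>\<ge>\<^sub>0"
    \<comment> \<open>The test function is \<open>z\<close> at every point but 0 and 1, that is, at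
      2.\<close>
    have "cinner (block_op T (x, y, z)) (x, y, z) \<in> \<real>\<^sub>\<ge>\<^sub>0" for x y z
      using spec[OF *, of "(\<lambda>_. z)(0 := x, 1 := y)"] by simp
    then show "positive_op (block_op T)"
      by (auto simp: positive_on_def)
  qed (simp add: positive_on_def)
  then show ?thesis
    unfolding positive_definite_fun_def sum using adj by auto
qed

section \<open>Completing the square and the second contraction\<close>

context
  fixes K :: "'a::chilbert_space set" and G :: "'a \<Rightarrow> 'a"
  assumes K: "csubspace K" "closed K" and G: "contraction_on K K G"
begin

context
begin

private abbreviation (input) "H \<equiv> adjoint_on K G"
private abbreviation (input) "D \<equiv> defect_op K G"
private abbreviation (input) "D' \<equiv> defect_op K H"

private lemma bounded_op_on_G: "bounded_op_on K K G"
  using G contraction_on_iff[OF K(1)] by auto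

private lemmas contraction_on_H = contraction_on_adjoint[OF K K(1) bounded_op_on_G G]
private lemmas psd_on_D = psd_on_defect_op[OF K K(1) G]
private lemmas psd_on_D' = psd_on_defect_op[OF K K(1) contraction_on_H]

private lemma in_K:
  assumes "x \<in> K"
  shows "G x \<in> K" "H x \<in> K" "D x \<in> K" "D' x \<in> K"
  using assms bounded_op_onD(1)[OF K(1)] bounded_op_on_G adjoint_on_in[OF K K(1) bounded_op_on_G]
    psd_on_bounded[OF psd_on_D] psd_on_bounded[OF psd_on_D'] by blast+

private lemma contraction_on_defect_spaces:
  assumes "contraction_on (defect_space K G) (defect_space K H) G1" "w \<in> K"
  shows "G1 (D w) \<in> K" "norm (G1 (D w)) \<le> norm (D w)"
proof -
  have "defect_space K H \<subseteq> K"
    unfolding defect_space_def by (rule closure_minimal) (use in_K K(2) in auto)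
  moreover have "D w \<in> defect_space K G"
    unfolding defect_space_def by (intro subsetD[OF closure_subset] imageI assms(2))
  moreover have "csubspace (defect_space K G)"
    unfolding defect_space_def
    by (rule csubspace_closure[OF csubspace_image[OF K(1) psd_on_bounded[OF psd_on_D]]])
  ultimately show "G1 (D w) \<in> K" "norm (G1 (D w)) \<le> norm (D w)"
    using assms(1) by (auto simp: contraction_on_iff bounded_op_on_def)
qed

text \<open>In the expanded square, the norms of the images of \<open>u\<close> and \<open>w\<close>
  are compensated by the defect identities. The product of these two images is
  \<open>inner (G (G w)) u\<close>, which has to be subtracted from the free coupling term
  \<open>b\<close>.\<close>

lemma complete_square:
  assumes "u \<in> K" "v \<in> K" "w \<in> K"
  shows "inner u u + inner v v + inner w w + 2 * (inner (G v) u + inner (G w) v + b) =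
    (norm (v + adjoint_on K G u + G w))\<^sup>2 + (norm (defect_op K (adjoint_on K G) u))\<^sup>2
      + (norm (defect_op K G w))\<^sup>2 + 2 * (b - inner (G (G w)) u)"
proof -
  note adj = adjoint_on_inner[OF K K(1) bounded_op_on_G]
  show ?thesis
    unfolding norm_defect_op[OF K K(1) G assms(3)] norm_defect_op[OF K K(1) contraction_on_H assms(1)]
      adj[OF assms(2)] adj[OF in_K(1)[OF assms(3)]]
    by (simp add: power2_norm_eq_inner inner_simps inner_commute)
qed

text \<open>After completing the square the coupling is \<open>inner (G1 (D w)) (D' u)\<close>, at
  least minus the product of the two defect norms because \<open>G1\<close> is a contraction; the
  two defect squares absorb twice that.\<close>

lemma form_nonneg_of_contraction:
  assumes G1: "contraction_on (defect_space K G) (defect_space K (adjoint_on K G)) G1"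
    and uvw: "u \<in> K" "v \<in> K" "w \<in> K"
  shows "0 \<le> inner u u + inner v v + inner w w + 2 * (inner (G v) u + inner (G w) v +
    inner (defect_op K (adjoint_on K G) (G1 (defect_op K G w)) + G (G w)) u)"
    (is "0 \<le> _ + 2 * (_ + _ + ?b)")
proof -
  let ?g = "G1 (D w)"
  note g = contraction_on_defect_spaces[OF G1 uvw(3)]
  have b: "?b - inner (G (G w)) u = inner ?g (D' u)"
    using psd_on_sym[OF psd_on_D' g(1) uvw(1)] by (simp add: inner_add_left)
  have "- (norm (D w) * norm (D' u)) \<le> inner ?g (D' u)"
    using Cauchy_Schwarz_ineq2[of ?g "D' u"] mult_right_mono[OF g(2), of "norm (D' u)"] by simp
  moreover have "0 \<le> (norm (D w) - norm (D' u))\<^sup>2" by simp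
  ultimately have "0 \<le> (norm (D w))\<^sup>2 + (norm (D' u))\<^sup>2 + 2 * inner ?g (D' u)"
    unfolding power2_diff by linarith
  then show ?thesis
    unfolding complete_square[OF uvw] b using zero_le_power2[of "norm (v + H u + G w)"] by linarith
qed

text \<open>Once \<open>v\<close> removes the square, scaling \<open>w\<close> by a real
  \<open>t\<close> leaves a quadratic in \<open>t\<close>. Its discriminant bounds the form of
  \<open>\<Theta> - G^2\<close> by the two defect norms, and such a form factors through the defect
  operators. Later \<open>\<Theta>\<close> is the adjoint of \<open>G\<close>.\<close>

lemma contraction_of_form_nonneg:
  assumes \<Theta>: "bounded_op_on K K \<Theta>"
    and nonneg: "\<And>u v w. u \<in> K \<Longrightarrow> v \<in> K \<Longrightarrow> w \<in> K \<Longrightarrow>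
      0 \<le> inner u u + inner v v + inner w w + 2 * (inner (G v) u + inner (G w) v + inner (\<Theta> w) u)"
  obtains G1 where "contraction_on (defect_space K G) (defect_space K (adjoint_on K G)) G1"
    "\<And>w. w \<in> K \<Longrightarrow> \<Theta> w = defect_op K (adjoint_on K G) (G1 (defect_op K G w)) + G (G w)"
proof -
  note bG = bounded_op_on_G and bD = psd_on_bounded[OF psd_on_D] and bD' = psd_on_bounded[OF psd_on_D']
  have UNIV: "bounded_op_on K UNIV A" if "bounded_op_on K K A" for A
    using that by (auto simp: bounded_op_on_def)
  have \<Theta>_in: "\<Theta> w \<in> K" if "w \<in> K" for w
    using that bounded_op_onD(1)[OF K(1) \<Theta>] by blast
  define C where "C w = \<Theta> w - G (G w)" for w
  have bC: "bounded_op_on K K C"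
  proof -
    obtain c where c: "\<And>w. w \<in> K \<Longrightarrow> norm (\<Theta> w) \<le> c * norm w"
      using bounded_op_on_bound[OF K(1) \<Theta>] by metis
    show ?thesis
    proof (rule bounded_op_onI[where k = "c + 1"])
      fix w assume w: "w \<in> K"
      have "norm (G (G w)) \<le> norm (G w)" "norm (G w) \<le> norm w"
        using G w in_K by (auto simp: contraction_on_iff[OF K(1)])
      then show "norm (C w) \<le> (c + 1) * norm w"
        unfolding C_def using c[OF w] norm_triangle_ineq4[of "\<Theta> w" "G (G w)"]
        by (simp add: distrib_right)
    qed (simp_all add: C_def in_K \<Theta>_in bounded_op_on_add[OF K(1) bG] bounded_op_on_scaleC[OF K(1) bG]
      bounded_op_on_add[OF K(1) \<Theta>] bounded_op_on_scaleC[OF K(1) \<Theta>] scaleC_diff_right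
      csubspace_diff[OF K(1)])
  qed
  have le: "\<bar>inner (C w) u\<bar> \<le> norm (D w) * norm (D' u)" if w: "w \<in> K" and u: "u \<in> K" for w u
  proof (rule abs_le_of_quadratic_nonneg)
    fix t :: real
    define w' where "w' = t *\<^sub>R w"
    define v where "v = - (H u + G w')"
    have w': "w' \<in> K"
      unfolding w'_def by (rule csubspace_scaleR[OF K(1) w])
    have v: "v \<in> K"
      unfolding v_def by (intro csubspace_minus[OF K(1)] csubspace_add[OF K(1)] in_K u w')
    have "0 \<le> (norm (v + H u + G w'))\<^sup>2 + (norm (D' u))\<^sup>2 + (norm (D w'))\<^sup>2
        + 2 * (inner (\<Theta> w') u - inner (G (G w')) u)"
      using nonneg[OF u v w'] unfolding complete_square[OF u v w'] .
    also have "v + H u + G w' = 0"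
      by (simp add: v_def)
    also have "D w' = t *\<^sub>R D w"
      unfolding w'_def by (rule bounded_op_on_scaleR[OF K(1) bD w])
    also have "inner (\<Theta> w') u - inner (G (G w')) u = inner (C w') u"
      by (simp add: C_def inner_diff_left)
    also have "C w' = t *\<^sub>R C w"
      unfolding w'_def by (rule bounded_op_on_scaleR[OF K(1) bC w])
    finally show "0 \<le> t\<^sup>2 * (norm (D w))\<^sup>2 + 2 * t * inner (C w) u + (norm (D' u))\<^sup>2"
      by (simp add: power_mult_distrib)
  qed simp_all
  obtain G1 where G1: "contraction_on (closure (D ` K)) (closure (D' ` K)) G1"
    "\<And>w u. w \<in> K \<Longrightarrow> u \<in> K \<Longrightarrow> inner (C w) u = inner (G1 (D w)) (D' u)"
    by (rule form_factorization[OF K(1) K(1) UNIV[OF bD] UNIV[OF bD'] UNIV[OF bC]], erule (1) le,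
        rule that)
  then have G1': "contraction_on (defect_space K G) (defect_space K H) G1"
    by (simp add: defect_space_def)
  have "\<Theta> w = D' (G1 (D w)) + G (G w)" if w: "w \<in> K" for w
  proof -
    note g = contraction_on_defect_spaces(1)[OF G1' w]
    have "C w = D' (G1 (D w))"
    proof (rule inner_closure_eqD[OF K(1)])
      \<comment> \<open>Symmetry moves \<open>D'\<close> off the test vector, turning the factorized
        form into an operator identity.\<close>
      show "inner u (C w) = inner u (D' (G1 (D w)))" if "u \<in> K" for u
        using G1(2)[OF w that] psd_on_sym[OF psd_on_D' g that] by (simp add: inner_commute)
      show "C w \<in> closure K" "D' (G1 (D w)) \<in> closure K"
        by (intro subsetD[OF closure_subset] bounded_op_onD(1)[OF K(1) bC w] in_K g)+
    qed
    then show ?thesis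
      by (simp add: C_def algebra_simps)
  qed
  with G1' show thesis
    by (rule that)
qed

end

end

section \<open>Transfer between \<open>B\<close> and the contractions through the root
  \<open>S\<close>\<close>

context
  fixes S B :: "'a::chilbert_space \<Rightarrow> 'a" and K
  assumes S: "psd_on UNIV S" and B: "bounded_op B"
  defines "K \<equiv> closure (range S)"
begin

private lemma K: "csubspace K" "closed K"
  unfolding K_def by (simp_all add: csubspace_closure csubspace_image[OF csubspace_UNIV psd_on_bounded[OF S]])

private lemma S_in: "S x \<in> K"
  unfolding K_def by (intro subsetD[OF closure_subset] rangeI)

text \<open>Symmetry of \<open>S\<close> rewrites the form in the variables \<open>S x\<close>,
  \<open>S y\<close>, \<open>S z\<close>. The pairing \<open>inner (B x) z\<close> is first passed
  to the adjoint of \<open>B\<close>, where the formula with \<open>G1\<close> applies.\<close>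

lemma block_form_nonneg_of_contractions:
  assumes G: "contraction_on K K G"
    and G1: "contraction_on (defect_space K G) (defect_space K (adjoint_on K G)) G1"
    and B_eq: "B = (\<lambda>x. S (G (S x)))"
    and adj_eq: "adjoint_op B = (\<lambda>x. S (defect_op K (adjoint_on K G) (G1 (defect_op K G (S x)))) +
      S (G (G (S x))))"
  shows "0 \<le> inner (S x) (S x) + inner (S y) (S y) + inner (S z) (S z)
    + 2 * (inner (B y) x + inner (B z) y + inner (B x) z)"
proof -
  have "inner (B y) x = inner (G (S y)) (S x)" for x y
    using psd_on_sym[OF S] by (simp add: B_eq)
  moreover have "inner (B x) z =
      inner (defect_op K (adjoint_on K G) (G1 (defect_op K G (S z))) + G (G (S z))) (S x)"
    using adjoint_on_inner[OF csubspace_UNIV closed_UNIV csubspace_UNIV B, of x z]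
      psd_on_sym[OF S, of _ x] by (simp add: adj_eq inner_add_left inner_add_right inner_commute)
  ultimately show ?thesis
    using form_nonneg_of_contraction[OF K G G1 S_in S_in S_in, of x y z] by simp
qed

lemma contractions_of_block_form_nonneg:
  assumes nonneg: "\<And>x y z. 0 \<le> inner (S x) (S x) + inner (S y) (S y) + inner (S z) (S z)
    + 2 * (inner (B y) x + inner (B z) y + inner (B x) z)"
  obtains G G1 where "contraction_on K K G"
    "contraction_on (defect_space K G) (defect_space K (adjoint_on K G)) G1"
    "B = (\<lambda>x. S (G (S x)))"
    "adjoint_op B = (\<lambda>x. S (defect_op K (adjoint_on K G) (G1 (defect_op K G (S x)))) +
      S (G (G (S x))))"
proof -
  note bS = psd_on_bounded[OF S]
  have le: "\<bar>inner (B y) x\<bar> \<le> norm (S y) * norm (S x)" for x y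
  proof (rule abs_le_of_quadratic_nonneg)
    fix t :: real
    \<comment> \<open>The third vector is set to 0 and the second is scaled by \<open>t\<close>,
      which leaves only one off-diagonal pairing.\<close>
    show "0 \<le> t\<^sup>2 * (norm (S y))\<^sup>2 + 2 * t * inner (B y) x + (norm (S x))\<^sup>2"
      using nonneg[of x "t *\<^sub>R y" 0] bounded_op_on_zero[OF csubspace_UNIV bS]
        bounded_op_on_zero[OF csubspace_UNIV B]
      by (simp add: bounded_op_on_scaleR[OF csubspace_UNIV bS] bounded_op_on_scaleR[OF csubspace_UNIV B]
          dot_square_norm power_mult_distrib algebra_simps)
  qed simp_all
  obtain G where G: "contraction_on K K G" "\<And>x y. inner (B x) y = inner (G (S x)) (S y)"
    using form_factorization[OF csubspace_UNIV csubspace_UNIV bS bS B le] unfolding K_def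
    by (metis UNIV_I)
  have B_eq: "B = (\<lambda>x. S (G (S x)))"
  proof
    fix x
    have "inner (B x) y = inner (S (G (S x))) y" for y
      using psd_on_sym[OF S] by (simp add: G(2))
    then show "B x = S (G (S x))"
      by (intro inner_closure_eqD[OF csubspace_UNIV]) (simp_all add: inner_commute)
  qed
  let ?H = "adjoint_on K G"
  have bG: "bounded_op_on K K G"
    using G(1) contraction_on_iff[OF K(1)] by blast
  note bH = bounded_op_on_adjoint[OF K K(1) bG]
  have B_H: "inner (B x) z = inner (S x) (?H (S z))" for x z
    by (simp add: G(2) adjoint_on_inner[OF K K(1) bG S_in])
  \<comment> \<open>The hypothesis controls the form only on the range of \<open>S\<close>. Since
    \<open>G\<close> and its adjoint are bounded on \<open>K\<close>, approximation by vectors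
    \<open>S (x n)\<close> extends it to the closure.\<close>
  have form: "0 \<le> inner u u + inner v v + inner w w + 2 * (inner (G v) u + inner (G w) v + inner (?H w) u)"
    if uvw: "u \<in> K" "v \<in> K" "w \<in> K" for u v w
  proof -
    have "\<exists>f. (\<lambda>n. S (f n)) \<longlonglongrightarrow> k" if "k \<in> K" for k
    proof -
      obtain g where g: "\<forall>n. g n \<in> range S" "g \<longlonglongrightarrow> k"
        using \<open>k \<in> K\<close> unfolding K_def closure_sequential by blast
      then have "\<forall>n. \<exists>x. g n = S x"
        by auto
      then obtain f where "\<forall>n. g n = S (f n)"
        by (rule choice[THEN exE])
      then have "g = (\<lambda>n. S (f n))"
        by auto
      with g(2) show ?thesis
        by blast
    qed
    then obtain x y z where lim: "(\<lambda>n. S (x n)) \<longlonglongrightarrow> u" "(\<lambda>n. S (y n)) \<longlonglongrightarrow> v" "(\<lambda>n. S (z n)) \<longlonglongrightarrow> w"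
      using uvw by meson
    have "(\<lambda>n. inner (S (x n)) (S (x n)) + inner (S (y n)) (S (y n)) + inner (S (z n)) (S (z n))
        + 2 * (inner (G (S (y n))) (S (x n)) + inner (G (S (z n))) (S (y n)) + inner (?H (S (z n))) (S (x n))))
      \<longlonglongrightarrow> inner u u + inner v v + inner w w + 2 * (inner (G v) u + inner (G w) v + inner (?H w) u)"
      by (intro tendsto_intros lim bounded_op_on_tendsto[OF K(1) bG] bounded_op_on_tendsto[OF K(1) bH]
          S_in uvw)
    then show ?thesis
    proof (rule LIMSEQ_le_const, intro exI allI impI)
      fix n
      show "0 \<le> inner (S (x n)) (S (x n)) + inner (S (y n)) (S (y n)) + inner (S (z n)) (S (z n))
        + 2 * (inner (G (S (y n))) (S (x n)) + inner (G (S (z n))) (S (y n)) + inner (?H (S (z n))) (S (x n)))"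
        using nonneg[of "x n" "y n" "z n"] B_H[of "x n" "z n"]
        by (simp add: G(2)) (simp add: inner_commute)
    qed
  qed
  obtain G1 where G1: "contraction_on (defect_space K G) (defect_space K ?H) G1"
    "\<And>w. w \<in> K \<Longrightarrow> ?H w = defect_op K ?H (G1 (defect_op K G w)) + G (G w)"
    by (rule contraction_of_form_nonneg[OF K G(1) bH], erule (2) form, rule that)
  \<comment> \<open>The adjoint of \<open>S G S\<close> is \<open>S ?H S\<close>; substituting the
    decomposition of \<open>?H\<close> gives the second formula.\<close>
  have "adjoint_op B z = S (?H (S z))" for z
    by (rule adjoint_on_eqI[OF csubspace_UNIV closed_UNIV csubspace_UNIV B])
      (simp_all add: B_H psd_on_sym[OF S])
  then have "adjoint_op B = (\<lambda>x. S (defect_op K ?H (G1 (defect_op K G (S x)))) + S (G (G (S x))))"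
    by (simp add: fun_eq_iff G1(2)[OF S_in] bounded_op_on_add[OF csubspace_UNIV bS])
  with G(1) G1(1) B_eq show thesis
    by (rule that)
qed

end

theorem proposition3p14:
  fixes T :: "3 \<Rightarrow> 'a::chilbert_space \<Rightarrow> 'a"
  assumes "\<And>s. bounded_op (T s)"
    and "T 2 = adjoint_op (T 1)"
  defines "S \<equiv> sqrt_op (T 0)"
    and "K \<equiv> closure (range (T 0))"
  defines "P1 \<equiv> positive_definite_fun T"
    and "P2 \<equiv> bounded_op (block_op T) \<and> positive_op (block_op T)"
    and "P3 \<equiv> positive_op (T 0) \<and>
      (\<exists>\<Gamma>0 \<Gamma>1.
        contraction_on K K \<Gamma>0 \<and>
        contraction_on (defect_space K \<Gamma>0) (defect_space K (adjoint_on K \<Gamma>0)) \<Gamma>1 \<and>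
        T 1 = (\<lambda>x. S (\<Gamma>0 (S x))) \<and>
        adjoint_op (T 1) =
          (\<lambda>x. S (defect_op K (adjoint_on K \<Gamma>0) (\<Gamma>1 (defect_op K \<Gamma>0 (S x))))
               + S (\<Gamma>0 (\<Gamma>0 (S x)))))"
  shows "(P1 \<longleftrightarrow> P2) \<and> (P2 \<longleftrightarrow> P3)"
proof
  have P2: "P2 \<longleftrightarrow> positive_op (block_op T)"
    unfolding P2_def using bounded_op_block_op[of T] assms(1) by blast
  then show "P1 \<longleftrightarrow> P2"
    unfolding P1_def using positive_definite_fun_3_iff[of T] assms(1,2) by blast
  have psd_iff: "psd_on UNIV (T 0) \<longleftrightarrow> positive_op (T 0)"
    using psd_on_iff[OF csubspace_UNIV, of "T 0"] assms(1) by blast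
  show "P2 \<longleftrightarrow> P3"
  \<comment> \<open>Only for positive \<open>T 0\<close> is \<open>S\<close> known to be its root.
    Otherwise both conditions fail, as each includes or implies positivity of
    \<open>T 0\<close>.\<close>
  proof (cases "psd_on UNIV (T 0)")
    case True
    have S: "psd_on UNIV S" and SS: "\<And>x. S (S x) = T 0 x"
      using psd_on_sqrt_on[OF csubspace_UNIV closed_UNIV True]
        sqrt_on_sqrt_on[OF csubspace_UNIV closed_UNIV True] by (auto simp: S_def)
    have K: "K = closure (range S)"
      using closure_range_sqrt_op[OF True] by (simp add: K_def S_def)
    have "inner (T 0 x) x = inner (S x) (S x)" for x
      using psd_on_sym[OF S, of "S x" x] by (simp add: SS)
    then have P2': "P2 \<longleftrightarrow> (\<forall>x y z. 0 \<le> inner (S x) (S x) + inner (S y) (S y) + inner (S z) (S z)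
        + 2 * (inner (T 1 y) x + inner (T 1 z) y + inner (T 1 x) z))"
      unfolding P2 block_op_positive_iff[of T, OF assms(1) assms(1)] using True by simp
    show ?thesis
    proof
      assume P2
      then have nonneg: "0 \<le> inner (S x) (S x) + inner (S y) (S y) + inner (S z) (S z)
        + 2 * (inner (T 1 y) x + inner (T 1 z) y + inner (T 1 x) z)" for x y z
        using P2' by blast
      show P3
        unfolding P3_def psd_iff[symmetric] K
        by (rule contractions_of_block_form_nonneg[OF S assms(1) nonneg])
          (intro conjI True exI; assumption)
    next
      assume P3
      then show P2
        unfolding P3_def K P2' by (elim conjE exE) (intro allI block_form_nonneg_of_contractions[OF S assms(1)])
    qed
  next
    case False
    then show ?thesis
      unfolding P2 P3_def psd_iff[symmetric] block_op_positive_iff[of T, OF assms(1) assms(1)]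
      by simp
  qed
qed

end
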